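(* Let $A$ be a non-empty set. Let $F$ be the intersection of all r-closed vector sublattices of $H(\mathbb{R}^A)$ containing $\mathrm{FVL}(A)$. Then $F$ (together with the map $A\to F$, $a\mapsto\delta_a$) is a free UCVL over $A$.
   Context: All vector lattices are real. $H(\mathbb{R}^A)$ is the vector lattice (pointwise operations and order) of all functions $h:\mathbb{R}^A\to\mathbb{R}$ that are continuous in the product topology and positively homogeneous ($h(t\xi)=t\,h(\xi)$ for all $t\ge0$, $\xi\in\mathbb{R}^A$). For $a\in A$, $\delta_a(\xi)=\xi(a)$ for $\xi\in\mathbb{R}^A$; $\mathrm{FVL}(A)$ is identified with the vector sublattice of $H(\mathbb{R}^A)$ generated by $\{\delta_a:a\in A\}$. A net $x_\alpha$ in a vector lattice $V$ r-converges to $x\in V$ with regulator $u\in V$ if for each $k\in\mathbb{N}$ there is $\alpha_k$ with $|x_\alpha-x|\le\frac1k|u|$ for all $\alpha\ge\alpha_k$. It is r$(u)$-Cauchy (with $u\in V$) if for each $k\in\mathbb{N}$ there is $\alpha_k$ with $|x_{\alpha'}-x_{\alpha''}|\le\frac1k|u|$ for all $\alpha',\alpha''\ge\alpha_k$. A vector sublattice $W$ of $V$ is r-closed in $V$ if whenever a sequence in $W$ r-converges to $x\in V$ with a regulator $u\in V$, then $x\in W$. A UCVL (uniformly complete vector lattice) is an Archimedean vector lattice $V$ such that for every $u\in V$, every r$(u)$-Cauchy net in $V$ r-converges to some element of $V$ with some regulator in $V$ (sequences suffice). A free UCVL over $A$ (denoted $\mathrm{FUCVL}(A)$) is a pair $(F,f)$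 with $F$ a UCVL and $f:A\to F$ an embedding (injective map) such that for every UCVL $E$ and every embedding (injective map) $q:A\to E$ there is a unique Riesz homomorphism $T:F\to E$ with $q=T\circ f$. *)

theory Defs
  imports
    "HOL-Analysis.Analysis"
    "HOL-Library.Function_Algebras"
    "HOL-Library.Lattice_Algebras"
begin

class vector_lattice = ordered_real_vector + lattice_ab_group_add

instance real :: vector_lattice ..

instantiation "fun" :: (type, real_vector) real_vector
begin

definition scaleR_fun :: "real \<Rightarrow> ('a \<Rightarrow> 'b) \<Rightarrow> 'a \<Rightarrow> 'b" where
  "scaleR_fun c f = (\<lambda>x. c *\<^sub>R f x)"

instance
  by standard
    (simp_all add: scaleR_fun_def fun_eq_iff scaleR_add_right scaleR_add_left)

end

instance "fun" :: (type, vector_lattice) vector_lattice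
  by standard
    (simp_all add: scaleR_fun_def le_fun_def scaleR_left_mono scaleR_right_mono)

definition modulus :: "'v::vector_lattice \<Rightarrow> 'v" where
  "modulus x = sup x (- x)"


(* A concrete vector lattice is a vector sublattice V of some type of class vector_lattice;
   V = UNIV is the type itself. *)

definition vector_sublattice :: "'v::vector_lattice set \<Rightarrow> bool" where
  "vector_sublattice V \<longleftrightarrow>
     subspace V \<and> (\<forall>x\<in>V. \<forall>y\<in>V. sup x y \<in> V \<and> inf x y \<in> V)"

definition archimedean :: "'v::vector_lattice set \<Rightarrow> bool" where
  "archimedean V \<longleftrightarrow>
     (\<forall>x\<in>V. \<forall>y\<in>V. (\<forall>n::nat. n > 0 \<longrightarrow> real n *\<^sub>R x \<le> y) \<longrightarrow> x \<le> 0)"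

(* A net is a family x together with the filter G of eventual properties of its index set.
   See r_converges_net and r_cauchy_net below for the formulation with directed index sets. *)

definition r_converges :: "('i \<Rightarrow> 'v::vector_lattice) \<Rightarrow> 'v \<Rightarrow> 'v \<Rightarrow> 'i filter \<Rightarrow> bool" where
  "r_converges x l u G \<longleftrightarrow>
     (\<forall>k::nat. k > 0 \<longrightarrow>
        (\<forall>\<^sub>F a in G. modulus (x a - l) \<le> (1 / real k) *\<^sub>R modulus u))"

definition r_cauchy :: "('i \<Rightarrow> 'v::vector_lattice) \<Rightarrow> 'v \<Rightarrow> 'i filter \<Rightarrow> bool" where
  "r_cauchy x u G \<longleftrightarrow>
     (\<forall>k::nat. k > 0 \<longrightarrow>
        (\<forall>\<^sub>F (a, b) in G \<times>\<^sub>F G. modulus (x a - x b) \<le> (1 / real k) *\<^sub>R modulus u))"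

definition r_closed_in :: "'v::vector_lattice set \<Rightarrow> 'v set \<Rightarrow> bool" where
  "r_closed_in W V \<longleftrightarrow>
     (\<forall>x l u. (\<forall>n::nat. x n \<in> W) \<longrightarrow> l \<in> V \<longrightarrow> u \<in> V \<longrightarrow>
        r_converges x l u sequentially \<longrightarrow> l \<in> W)"

(* Quantifying over all nets in V, of whatever index type, amounts to quantifying over all
   proper filters G on V: push the filter of the index set forward along the net. *)

definition uniformly_complete :: "'v::vector_lattice set \<Rightarrow> bool" where
  "uniformly_complete V \<longleftrightarrow>
     (\<forall>u\<in>V. \<forall>G. G \<noteq> bot \<longrightarrow> G \<le> principal V \<longrightarrow> r_cauchy (\<lambda>x. x) u G \<longrightarrow>
        (\<exists>l\<in>V. \<exists>w\<in>V. r_converges (\<lambda>x. x) l w G))"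

definition UCVL :: "'v::vector_lattice set \<Rightarrow> bool" where
  "UCVL V \<longleftrightarrow> vector_sublattice V \<and> archimedean V \<and> uniformly_complete V"

definition riesz_hom_on :: "'v::vector_lattice set \<Rightarrow> ('v \<Rightarrow> 'w::vector_lattice) \<Rightarrow> bool" where
  "riesz_hom_on V T \<longleftrightarrow>
     (\<forall>x\<in>V. \<forall>y\<in>V. T (x + y) = T x + T y) \<and>
     (\<forall>c. \<forall>x\<in>V. T (c *\<^sub>R x) = c *\<^sub>R T x) \<and>
     (\<forall>x\<in>V. \<forall>y\<in>V. T (sup x y) = sup (T x) (T y) \<and> T (inf x y) = inf (T x) (T y))"

(* The set A of generators is the (non-empty) type 'a. A definition cannot quantify over
   types, so the type 'e in which the test objects E live is a parameter; it is to be left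
   arbitrary. The values of T outside F are fixed by extensionality, so that uniqueness is
   uniqueness as a map from F to E. *)

definition free_UCVL ::
  "'e::vector_lattice itself \<Rightarrow> 'v::vector_lattice set \<Rightarrow> ('a \<Rightarrow> 'v) \<Rightarrow> bool" where
  "free_UCVL _ F f \<longleftrightarrow>
     UCVL F \<and> range f \<subseteq> F \<and> inj f \<and>
     (\<forall>(E :: 'e set) q. UCVL E \<longrightarrow> range q \<subseteq> E \<longrightarrow> inj q \<longrightarrow>
        (\<exists>!T. T \<in> F \<rightarrow>\<^sub>E E \<and> riesz_hom_on F T \<and> q = T \<circ> f))"


(* The topology on 'a => real is the product topology. *)

definition H :: "(('a \<Rightarrow> real) \<Rightarrow> real) set" where
  "H = {h. continuous_on UNIV h \<and> (\<forall>t\<ge>0. \<forall>\<xi>. h (t *\<^sub>R \<xi>) = t * h \<xi>)}"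

definition \<delta> :: "'a \<Rightarrow> ('a \<Rightarrow> real) \<Rightarrow> real" where
  "\<delta> a \<xi> = \<xi> a"

definition FVL :: "(('a \<Rightarrow> real) \<Rightarrow> real) set" where
  "FVL = \<Inter>{W. vector_sublattice W \<and> W \<subseteq> H \<and> range \<delta> \<subseteq> W}"


lemma eventually_tails:
  assumes "I \<noteq> {}" "\<forall>a\<in>I. r a a"
    and "\<forall>a\<in>I. \<forall>b\<in>I. \<forall>c\<in>I. r a b \<longrightarrow> r b c \<longrightarrow> r a c"
    and "\<forall>a\<in>I. \<forall>b\<in>I. \<exists>c\<in>I. r a c \<and> r b c"
  shows "eventually P (INF a\<in>I. principal {b\<in>I. r a b}) \<longleftrightarrow>
           (\<exists>a\<in>I. \<forall>b\<in>I. r a b \<longrightarrow> P b)"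
proof -
  have "eventually P (INF a\<in>I. principal {b\<in>I. r a b}) \<longleftrightarrow>
          (\<exists>a\<in>I. eventually P (principal {b\<in>I. r a b}))"
  proof (rule eventually_INF_base)
    fix a b assume ab: "a \<in> I" "b \<in> I"
    then obtain c where c: "c \<in> I" "r a c" "r b c" using assms(4) by blast
    have "{d\<in>I. r c d} \<subseteq> {d\<in>I. r a d} \<inter> {d\<in>I. r b d}"
      using ab c assms(3) by blast
    then show "\<exists>x\<in>I. principal {d\<in>I. r x d} \<le>
        inf (principal {d\<in>I. r a d}) (principal {d\<in>I. r b d})"
      using c(1) by (intro bexI[of _ c]) (simp_all only: inf_principal principal_le_iff)
  qed (rule assms(1))
  then show ?thesis by (simp add: eventually_principal Ball_def imp_conjL)
qed

lemma r_converges_net: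
  assumes "I \<noteq> {}" "\<forall>a\<in>I. r a a"
    and "\<forall>a\<in>I. \<forall>b\<in>I. \<forall>c\<in>I. r a b \<longrightarrow> r b c \<longrightarrow> r a c"
    and "\<forall>a\<in>I. \<forall>b\<in>I. \<exists>c\<in>I. r a c \<and> r b c"
  shows "r_converges x l u (INF a\<in>I. principal {b\<in>I. r a b}) \<longleftrightarrow>
    (\<forall>k::nat. k > 0 \<longrightarrow>
      (\<exists>a\<in>I. \<forall>b\<in>I. r a b \<longrightarrow> modulus (x b - l) \<le> (1 / real k) *\<^sub>R modulus u))"
  unfolding r_converges_def eventually_tails[OF assms] ..

lemma r_cauchy_net:
  assumes "I \<noteq> {}" "\<forall>a\<in>I. r a a"
    and "\<forall>a\<in>I. \<forall>b\<in>I. \<forall>c\<in>I. r a b \<longrightarrow> r b c \<longrightarrow> r a c"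
    and "\<forall>a\<in>I. \<forall>b\<in>I. \<exists>c\<in>I. r a c \<and> r b c"
  shows "r_cauchy x u (INF a\<in>I. principal {b\<in>I. r a b}) \<longleftrightarrow>
    (\<forall>k::nat. k > 0 \<longrightarrow>
      (\<exists>a\<in>I. \<forall>b\<in>I. \<forall>c\<in>I. r a b \<longrightarrow> r a c \<longrightarrow>
         modulus (x b - x c) \<le> (1 / real k) *\<^sub>R modulus u))"
proof -
  have *: "(\<forall>\<^sub>F (b, c) in F \<times>\<^sub>F F. R b c) \<longleftrightarrow> (\<exists>a\<in>I. \<forall>b\<in>I. \<forall>c\<in>I. r a b \<longrightarrow> r a c \<longrightarrow> R b c)"
    if "F = (INF a\<in>I. principal {b\<in>I. r a b})" for R F
  proof
    assume "\<forall>\<^sub>F (b, c) in F \<times>\<^sub>F F. R b c"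
    then obtain Q where "eventually Q F" "\<forall>b c. Q b \<longrightarrow> Q c \<longrightarrow> R b c"
      by (auto simp: eventually_prod_same)
    then show "\<exists>a\<in>I. \<forall>b\<in>I. \<forall>c\<in>I. r a b \<longrightarrow> r a c \<longrightarrow> R b c"
      unfolding that eventually_tails[OF assms] by blast
  next
    assume "\<exists>a\<in>I. \<forall>b\<in>I. \<forall>c\<in>I. r a b \<longrightarrow> r a c \<longrightarrow> R b c"
    then obtain a where a: "a \<in> I" "\<forall>b\<in>I. \<forall>c\<in>I. r a b \<longrightarrow> r a c \<longrightarrow> R b c" by blast
    then have "eventually (\<lambda>b. b \<in> I \<and> r a b) F"
      unfolding that eventually_tails[OF assms] by blast
    then show "\<forall>\<^sub>F (b, c) in F \<times>\<^sub>F F. R b c"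
      using a(2) unfolding eventually_prod_same
      by (intro exI[of _ "\<lambda>b. b \<in> I \<and> r a b"]) simp
  qed
  show ?thesis unfolding r_cauchy_def *[OF refl] ..
qed

end

theory Submission
  imports Defs "HOL-Library.Product_Order"
begin

text \<open>
  Both halves of freeness rest on the fact that $\mathrm{FVL}$ majorizes \<open>H\<close> (\<open>FVL_majorizes_H\<close>):
  continuity at \<open>0\<close> in the product topology controls a function by finitely many coordinates, and
  homogeneity turns that control into a bound by a positive combination of finitely many moduli
  of coordinates. Regulators in \<open>H\<close> can therefore be traded for regulators in \<open>FVL\<close>, on which a
  homomorphism out of \<open>F\<close> is defined, so every Riesz homomorphism on \<open>F\<close> respects the limits that
  define \<open>F\<close>. Uniqueness follows: two homomorphisms that agree on the generators agree on an r-closed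
  vector sublattice (\<open>riesz_hom_eq_on_limit\<close>).

  For existence, a homomorphism into \<open>E\<close> is treated as a vector sublattice \<open>G\<close> of the product \<open>H \<times> E\<close>
  that contains no \<open>(0, y)\<close> with \<open>y \<noteq> 0\<close>. Such a graph is automatically order preserving.

  To start, the vector lattice generated by the pairs \<open>(\<delta> a, q a)\<close> is such a graph
  (\<open>generated_hom_graph\<close>). This says that a lattice-linear identity between real numbers holds in every
  vector lattice. Each element of the generated lattice is a difference of finite suprema of linear
  combinations, so only inequalities of the form \<open>l \<le> sup b\<^sub>j\<close> between linear forms matter. By Gordan's
  alternative, such an inequality on all of $\mathbb{R}^A$ forces \<open>l\<close> to be a convex combination of the
  \<open>b\<^sub>j\<close>, and this certificate can be read in \<open>E\<close>.

  To continue, a graph stays a graph when limits regulated by its own elements are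
  added (\<open>hom_graph_r_closure\<close>), since \<open>E\<close> is Archimedean. One such step need not reach an r-closed set.
  Instead of iterating transfinitely, Zorn's lemma provides a maximal graph, which
  absorbs its own closure. As \<open>E\<close> is uniformly complete and \<open>FVL\<close> majorizes \<open>H\<close>, the domain of a maximal
  graph is r-closed in \<open>H\<close> (\<open>hom_graph_r_closed_domain\<close>), hence contains \<open>F\<close>.

  Finally, \<open>F\<close> is uniformly complete because regulated convergence in \<open>H\<close> is locally uniform: the
  pointwise limit of an r-Cauchy filter is again continuous and homogeneous
  (\<open>H_r_cauchy_limit\<close>), and a sequence extracted from the filter puts it into the r-closed set \<open>F\<close>.
\<close>

section \<open>Vector lattices\<close>

text \<open>
  Graphs of homomorphisms live in products. The arities climb the class hierarchy one class at a
  time: products of ordered Euclidean spaces already belong to all these classes, and a more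
  general arity for a class is accepted only if its superclasses are at least as general.
\<close>

instance prod :: (ordered_ab_semigroup_add, ordered_ab_semigroup_add) ordered_ab_semigroup_add
  by standard (auto simp: less_eq_prod_def intro: add_left_mono)

instance prod :: (ordered_cancel_ab_semigroup_add, ordered_cancel_ab_semigroup_add) ordered_cancel_ab_semigroup_add
  ..

instance prod :: (ordered_comm_monoid_add, ordered_comm_monoid_add) ordered_comm_monoid_add
  ..

instance prod :: (ordered_cancel_comm_monoid_add, ordered_cancel_comm_monoid_add) ordered_cancel_comm_monoid_add
  ..

instance prod :: (ordered_ab_semigroup_add_imp_le, ordered_ab_semigroup_add_imp_le) ordered_ab_semigroup_add_imp_le
  by standard (simp add: less_eq_prod_def)

instance prod :: (ordered_ab_semigroup_monoid_add_imp_le, ordered_ab_semigroup_monoid_add_imp_le) ordered_ab_semigroup_monoid_add_imp_le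
  ..

instance prod :: (ordered_ab_group_add, ordered_ab_group_add) ordered_ab_group_add
  ..

instance prod :: (ordered_real_vector, ordered_real_vector) ordered_real_vector
  by standard (auto simp: less_eq_prod_def intro: scaleR_left_mono scaleR_right_mono)

instance prod :: (lattice_ab_group_add, lattice_ab_group_add) lattice_ab_group_add ..

instance prod :: (vector_lattice, vector_lattice) vector_lattice ..

context
  fixes x y :: "'v::vector_lattice"
begin

lemma modulus_le_iff: "modulus x \<le> y \<longleftrightarrow> x \<le> y \<and> - x \<le> y"
  by (simp add: modulus_def)

lemma modulus_ge: "x \<le> modulus x" "- x \<le> modulus x"
  by (simp_all add: modulus_def)

lemma modulus_nonneg: "0 \<le> modulus x"
proof -
  have "x + - x \<le> modulus x + modulus x" by (intro add_mono modulus_ge)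
  then show ?thesis by simp
qed

lemma modulus_of_nonneg: "0 \<le> x \<Longrightarrow> modulus x = x"
  by (simp add: modulus_def sup_absorb1 order_trans[of "- x" 0 x])

lemma modulus_minus_commute: "modulus (x - y) = modulus (y - x)"
  by (simp add: modulus_def sup_commute)

end

lemma modulus_triangle:
  fixes x y :: "'v::vector_lattice"
  shows "modulus (x + y) \<le> modulus x + modulus y"
  using add_mono[OF modulus_ge(1) modulus_ge(1), of x y]
    add_mono[OF modulus_ge(2) modulus_ge(2), of x y]
  by (simp add: modulus_le_iff)

lemma modulus_triangle_diff:
  fixes x y z :: "'v::vector_lattice"
  shows "modulus (x - z) \<le> modulus (x - y) + modulus (y - z)"
  using modulus_triangle[of "x - y" "y - z"] by simp

lemma modulus_add_diff_le:
  fixes x y x' y' :: "'v::vector_lattice"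
  shows "modulus (x + y - (x' + y')) \<le> modulus (x - x') + modulus (y - y')"
  using modulus_triangle[of "x - x'" "y - y'"] by (simp add: algebra_simps)

lemma sup_le_sup_add_modulus:
  fixes x y x' y' :: "'v::vector_lattice"
  shows "sup x y \<le> sup x' y' + (modulus (x - x') + modulus (y - y'))"
proof (rule le_supI)
  have "x = x' + (x - x')" by simp
  also have "\<dots> \<le> sup x' y' + (modulus (x - x') + modulus (y - y'))"
    using add_mono[OF modulus_ge(1)[of "x - x'"] modulus_nonneg[of "y - y'"]]
    by (intro add_mono) auto
  finally show "x \<le> \<dots>" .
  have "y = y' + (y - y')" by simp
  also have "\<dots> \<le> sup x' y' + (modulus (x - x') + modulus (y - y'))"
    using add_mono[OF modulus_nonneg[of "x - x'"] modulus_ge(1)[of "y - y'"]]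
    by (intro add_mono) auto
  finally show "y \<le> \<dots>" .
qed

lemma modulus_sup_diff_le:
  fixes x y x' y' :: "'v::vector_lattice"
  shows "modulus (sup x y - sup x' y') \<le> modulus (x - x') + modulus (y - y')"
proof -
  have "sup x y - sup x' y' \<le> modulus (x - x') + modulus (y - y')"
    using sup_le_sup_add_modulus[of x y x' y'] by (metis diff_le_eq add.commute)
  moreover have "sup x' y' - sup x y \<le> modulus (x - x') + modulus (y - y')"
    using sup_le_sup_add_modulus[of x' y' x y]
    by (metis diff_le_eq add.commute modulus_minus_commute)
  ultimately show ?thesis unfolding modulus_le_iff minus_diff_eq by blast
qed

lemma modulus_scaleR_le:
  fixes x y :: "'v::vector_lattice"
  assumes "modulus x \<le> y"
  shows "modulus (c *\<^sub>R x) \<le> \<bar>c\<bar> *\<^sub>R y"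
proof (cases "0 \<le> c")
  case True
  then show ?thesis
    using assms scaleR_left_mono[of x y c] scaleR_left_mono[of "- x" y c]
    by (simp add: modulus_le_iff)
next
  case False
  then show ?thesis
    using assms scaleR_left_mono[of x y "- c"] scaleR_left_mono[of "- x" y "- c"]
    by (simp add: modulus_le_iff)
qed

lemma modulus_fst: "fst (modulus p) = modulus (fst p)"
  and modulus_snd: "snd (modulus p) = modulus (snd p)"
  by (simp_all add: modulus_def)

lemma modulus_apply: "modulus h \<xi> = \<bar>h \<xi>\<bar>" for h :: "'x \<Rightarrow> real"
  by (simp add: modulus_def sup_fun_def sup_real_def)

text \<open>
  Multiplication by \<open>c > 0\<close> is an order automorphism with inverse multiplication by \<open>inverse c\<close>.
\<close>

lemma scaleR_sup:
  fixes x y :: "'v::vector_lattice"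
  assumes "0 \<le> c"
  shows "c *\<^sub>R sup x y = sup (c *\<^sub>R x) (c *\<^sub>R y)"
proof (cases "c = 0")
  case False
  then have c: "0 < c" using assms by simp
  let ?s = "sup (c *\<^sub>R x) (c *\<^sub>R y)"
  have "inverse c *\<^sub>R (c *\<^sub>R x) \<le> inverse c *\<^sub>R ?s" "inverse c *\<^sub>R (c *\<^sub>R y) \<le> inverse c *\<^sub>R ?s"
    using c by (auto intro!: scaleR_left_mono simp del: scaleR_scaleR)
  then have "x \<le> inverse c *\<^sub>R ?s" "y \<le> inverse c *\<^sub>R ?s"
    using False by (simp_all only: scaleR_scaleR left_inverse scaleR_one not_False_eq_True)
  then have "sup x y \<le> inverse c *\<^sub>R ?s" by simp
  then have "c *\<^sub>R sup x y \<le> c *\<^sub>R (inverse c *\<^sub>R ?s)" using c by (intro scaleR_left_mono) auto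
  then have "c *\<^sub>R sup x y \<le> ?s" using c by simp
  moreover have "?s \<le> c *\<^sub>R sup x y" using assms by (intro le_supI scaleR_left_mono) auto
  ultimately show ?thesis by (rule order_antisym)
qed simp

lemma vector_sublatticeI:
  fixes V :: "'v::vector_lattice set"
  assumes "subspace V" "\<And>x y. x \<in> V \<Longrightarrow> y \<in> V \<Longrightarrow> sup x y \<in> V"
  shows "vector_sublattice V"
  unfolding vector_sublattice_def
proof (intro conjI ballI)
  fix x y assume "x \<in> V" "y \<in> V"
  then show "inf x y \<in> V"
    unfolding inf_eq_neg_sup by (intro subspace_neg[OF assms(1)] assms(2))
qed (use assms in auto)

context
  fixes V :: "'v::vector_lattice set"
  assumes V: "vector_sublattice V"
begin

lemma vector_sublattice_subspace: "subspace V"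
  using V by (simp add: vector_sublattice_def)

lemma vector_sublattice_closed:
  shows "0 \<in> V"
    and "x \<in> V \<Longrightarrow> y \<in> V \<Longrightarrow> x + y \<in> V"
    and "x \<in> V \<Longrightarrow> y \<in> V \<Longrightarrow> x - y \<in> V"
    and "x \<in> V \<Longrightarrow> - x \<in> V"
    and "x \<in> V \<Longrightarrow> c *\<^sub>R x \<in> V"
    and "x \<in> V \<Longrightarrow> y \<in> V \<Longrightarrow> sup x y \<in> V"
    and "x \<in> V \<Longrightarrow> y \<in> V \<Longrightarrow> inf x y \<in> V"
    and "x \<in> V \<Longrightarrow> modulus x \<in> V"
  using V vector_sublattice_subspace
  by (auto simp: vector_sublattice_def modulus_def intro: subspace_0 subspace_add subspace_diff
      subspace_neg subspace_scale)

end

lemma vector_sublattice_Inter: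
  "(\<And>W. W \<in> \<W> \<Longrightarrow> vector_sublattice W) \<Longrightarrow> vector_sublattice (\<Inter>\<W>)"
  by (auto simp: vector_sublattice_def intro: subspace_Inter)

lemma vector_sublattice_Times:
  assumes "vector_sublattice V" "vector_sublattice E"
  shows "vector_sublattice (V \<times> E)"
  using assms unfolding vector_sublattice_def
  by (simp add: subspace_Times sup_prod_def inf_prod_def mem_Times_iff)

lemma archimedeanD:
  fixes E :: "'v::vector_lattice set"
  assumes "archimedean E" "x \<in> E" "y \<in> E"
    and le: "\<And>k::nat. k > 0 \<Longrightarrow> x \<le> (1 / real k) *\<^sub>R y"
  shows "x \<le> 0"
proof -
  have "real n *\<^sub>R x \<le> y" if "n > 0" for n :: nat
    using scaleR_left_mono[OF le[OF that], of "real n"] that by simp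
  then show ?thesis using assms(1-3) unfolding archimedean_def by blast
qed

lemma archimedean_modulus_eq_0:
  fixes E :: "'v::vector_lattice set"
  assumes "archimedean E" "vector_sublattice E" "x \<in> E" "y \<in> E"
    and le: "\<And>k::nat. k > 0 \<Longrightarrow> modulus x \<le> (1 / real k) *\<^sub>R y"
  shows "x = 0"
proof -
  have "modulus x \<le> 0"
    using assms vector_sublattice_closed(8) by (intro archimedeanD[of E _ y]) auto
  then show ?thesis by (simp add: modulus_le_iff order_antisym)
qed

section \<open>The vector lattice generated by a subspace\<close>

text \<open>
  The vector lattice generated by a subspace consists of the differences of finite suprema of its
  elements. Compared with suprema of infima, this normal form makes closure under the lattice
  operations a matter of translation invariance:
  \<open>sup (a - b) (c - d) = sup (a + d) (c + b) - (b + d)\<close>.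
\<close>

inductive_set finite_sups :: "'v::vector_lattice set \<Rightarrow> 'v set" for L where
  base: "x \<in> L \<Longrightarrow> x \<in> finite_sups L"
| sup: "x \<in> finite_sups L \<Longrightarrow> y \<in> finite_sups L \<Longrightarrow> sup x y \<in> finite_sups L"

definition lattice_span :: "'v::vector_lattice set \<Rightarrow> 'v set" where
  "lattice_span L = {x - y | x y. x \<in> finite_sups L \<and> y \<in> finite_sups L}"

lemma finite_sups_add:
  fixes L :: "'v::vector_lattice set"
  assumes "subspace L" "x \<in> finite_sups L" "y \<in> finite_sups L"
  shows "x + y \<in> finite_sups L"
  using assms(2)
proof induction
  case (base x)
  from assms(3) show ?case
  proof induction
    case (base y)
    then show ?case using \<open>x \<in> L\<close> assms(1) by (blast intro: finite_sups.base subspace_add)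
  qed (simp add: add_sup_distrib_left finite_sups.sup)
qed (simp add: add_sup_distrib_right finite_sups.sup)

lemma finite_sups_scaleR:
  fixes L :: "'v::vector_lattice set"
  assumes "subspace L" "0 \<le> c" "x \<in> finite_sups L"
  shows "c *\<^sub>R x \<in> finite_sups L"
  using assms(3)
  by induction (auto simp: scaleR_sup[OF assms(2)] intro: finite_sups.intros
      subspace_scale[OF assms(1)])

lemma vector_sublattice_lattice_span:
  fixes L :: "'v::vector_lattice set"
  assumes L: "subspace L"
  shows "vector_sublattice (lattice_span L)"
proof (rule vector_sublatticeI)
  show "subspace (lattice_span L)"
  proof (rule subspaceI)
    show "0 \<in> lattice_span L"
      using subspace_0[OF L] finite_sups.base unfolding lattice_span_def by force
  next
    fix p q assume "p \<in> lattice_span L" "q \<in> lattice_span L"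
    then obtain a b c d where "p = a - b" "q = c - d"
      and *: "a \<in> finite_sups L" "b \<in> finite_sups L" "c \<in> finite_sups L" "d \<in> finite_sups L"
      unfolding lattice_span_def by blast
    then have "p + q = (a + c) - (b + d)" by simp
    with * L show "p + q \<in> lattice_span L" unfolding lattice_span_def by (blast intro: finite_sups_add)
  next
    fix r :: real and p assume "p \<in> lattice_span L"
    then obtain a b where p: "p = a - b" and *: "a \<in> finite_sups L" "b \<in> finite_sups L"
      unfolding lattice_span_def by blast
    show "r *\<^sub>R p \<in> lattice_span L"
    proof (cases "0 \<le> r")
      case True
      have "r *\<^sub>R p = r *\<^sub>R a - r *\<^sub>R b" by (simp add: p algebra_simps)
      with * L True show ?thesis unfolding lattice_span_def by (blast intro: finite_sups_scaleR)
    next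
      case False
      have "r *\<^sub>R p = (- r) *\<^sub>R b - (- r) *\<^sub>R a" by (simp add: p algebra_simps)
      moreover have "0 \<le> - r" using False by simp
      ultimately show ?thesis using * L unfolding lattice_span_def by (blast intro: finite_sups_scaleR)
    qed
  qed
next
  fix p q assume "p \<in> lattice_span L" "q \<in> lattice_span L"
  then obtain a b c d where pq: "p = a - b" "q = c - d"
    and *: "a \<in> finite_sups L" "b \<in> finite_sups L" "c \<in> finite_sups L" "d \<in> finite_sups L"
    unfolding lattice_span_def by blast
  have "sup p q + (b + d) = sup (a + d) (c + b)"
    unfolding add_sup_distrib_right by (simp add: pq algebra_simps)
  then have "sup p q = sup (a + d) (c + b) - (b + d)" by (metis add_diff_cancel_right')
  with * L show "sup p q \<in> lattice_span L"
    unfolding lattice_span_def by (blast intro: finite_sups_add finite_sups.sup)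
qed

lemma subset_lattice_span:
  fixes L :: "'v::vector_lattice set"
  assumes "subspace L" shows "L \<subseteq> lattice_span L"
proof
  fix x assume "x \<in> L"
  moreover have "x = x - 0" by simp
  ultimately show "x \<in> lattice_span L"
    using subspace_0[OF assms] unfolding lattice_span_def by (blast intro: finite_sups.base)
qed

text \<open>
  Gordan's theorem of the alternative, by induction on the number of functionals and for all
  subspaces \<open>K\<close> at once. When a functional \<open>f j\<close> is added, the induction hypothesis is used on \<open>K\<close> and
  on the kernel of \<open>f j\<close> in \<open>K\<close>. A nontrivial nonnegative combination of the others that vanishes on
  the kernel is a multiple of \<open>f j\<close> on \<open>K\<close>, and a point where the others are all positive shows that
  this multiple has the right sign. The formulation with functionals on an abstract space, rather
  than with a separating hyperplane, covers $\mathbb{R}^A$ for infinite \<open>A\<close>.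
\<close>

lemma gordan_alternative:
  fixes f :: "'i \<Rightarrow> 'x::real_vector \<Rightarrow> real"
  assumes "finite I" "subspace K" "\<And>i. i \<in> I \<Longrightarrow> linear (f i)"
    and "\<not> (\<exists>x\<in>K. \<forall>i\<in>I. f i x > 0)"
  shows "\<exists>c. (\<forall>i\<in>I. c i \<ge> 0) \<and> (\<exists>i\<in>I. c i > 0) \<and> (\<forall>x\<in>K. (\<Sum>i\<in>I. c i * f i x) = 0)"
  using assms
proof (induction I arbitrary: K rule: finite_induct)
  case empty
  then show ?case using subspace_0[of K] by auto
next
  case (insert j I)
  note lin = insert.prems(2)
  have lin_j: "linear (f j)" using lin by simp
  have extend: "(\<Sum>i\<in>insert j I. (if i = j then d else c i) * f i x) = d * f j x + (\<Sum>i\<in>I. c i * f i x)"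
    for c d x
    using insert.hyps by (auto intro!: sum.cong)
  show ?case
  proof (cases "\<exists>x\<in>K. \<forall>i\<in>I. f i x > 0")
    case False
    then obtain c where c: "\<forall>i\<in>I. c i \<ge> 0" "\<exists>i\<in>I. c i > 0" "\<forall>x\<in>K. (\<Sum>i\<in>I. c i * f i x) = 0"
      using insert.IH[OF insert.prems(1)] lin by blast
    then show ?thesis
      using insert.hyps(2) by (intro exI[of _ "\<lambda>i. if i = j then 0 else c i"]) (auto simp: extend simp del: sum.insert)
  next
    case True
    then obtain x1 where x1: "x1 \<in> K" "\<And>i. i \<in> I \<Longrightarrow> f i x1 > 0" by blast
    show ?thesis
    proof (cases "\<forall>x\<in>K. f j x = 0")
      case True
      then show ?thesis
        using insert.hyps by (intro exI[of _ "\<lambda>i. if i = j then 1 else 0"]) (auto simp: extend simp del: sum.insert)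
    next
      case False
      then obtain e0 where e0: "e0 \<in> K" "f j e0 \<noteq> 0" by blast
      obtain e where e: "e \<in> K" "f j e > 0"
      proof (cases "f j e0 > 0")
        case False
        then show ?thesis
          using e0 that[of "- e0"] insert.prems(1) by (simp add: subspace_neg linear_neg[OF lin_j])
      qed (use e0 that in blast)
      \<comment> \<open>The kernel is infeasible for \<open>I\<close>: a feasible point could be moved slightly along \<open>e\<close>.\<close>
      define K' where "K' = {x \<in> K. f j x = 0}"
      have K': "subspace K'"
        using insert.prems(1) unfolding K'_def subspace_def
        by (auto simp: linear_add[OF lin_j] linear_scale[OF lin_j] linear_0[OF lin_j])
      have infeasible: "\<not> (\<exists>x\<in>K'. \<forall>i\<in>I. f i x > 0)"
      proof
        assume "\<exists>x\<in>K'. \<forall>i\<in>I. f i x > 0"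
        then obtain x where x: "x \<in> K" "f j x = 0" "\<And>i. i \<in> I \<Longrightarrow> f i x > 0"
          unfolding K'_def by blast
        have "\<forall>\<^sub>F t in at_right 0. f i x + t * f i e > 0" if "i \<in> I" for i
        proof -
          have "((\<lambda>t. f i x + t * f i e) \<longlongrightarrow> f i x + 0 * f i e) (at_right 0)"
            by (intro tendsto_intros)
          then show ?thesis using x(3)[OF that] by (intro order_tendstoD(1)[of _ "f i x"]) simp_all
        qed
        then have "\<forall>\<^sub>F t in at_right 0. \<forall>i\<in>I. f i x + t * f i e > 0"
          using insert.hyps(1) by (simp add: eventually_ball_finite)
        moreover have "\<forall>\<^sub>F t in at_right 0. (t::real) > 0"
          by (simp add: eventually_at_right_less)
        ultimately have "\<forall>\<^sub>F t in at_right 0. (\<forall>i\<in>I. f i x + t * f i e > 0) \<and> t > 0"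
          by (rule eventually_conj)
        then obtain t :: real where t: "\<forall>i\<in>I. f i x + t * f i e > 0" "t > 0"
          using eventually_happens trivial_limit_at_right_real by blast
        have "x + t *\<^sub>R e \<in> K"
          using x(1) e(1) insert.prems(1) by (simp add: subspace_add subspace_scale)
        moreover have "f i (x + t *\<^sub>R e) = f i x + t * f i e" if "i \<in> insert j I" for i
          using lin[OF that] by (simp add: linear_add linear_scale)
        ultimately show False using insert.prems(3) t x(2) e(2) by force
      qed
      then obtain c where c: "\<forall>i\<in>I. c i \<ge> 0" "\<exists>i\<in>I. c i > 0"
          "\<forall>x\<in>K'. (\<Sum>i\<in>I. c i * f i x) = 0"
        using insert.IH[OF K'] lin by blast
      define g where "g x = (\<Sum>i\<in>I. c i * f i x)" for x
      have g_pos: "g x1 > 0"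
      proof -
        obtain i where "i \<in> I" "c i > 0" using c(2) by blast
        then show ?thesis
          unfolding g_def using c(1) x1(2) insert.hyps(1)
          by (intro sum_pos2[of I i]) (auto simp: less_imp_le)
      qed
      have fj: "f j x1 < 0"
      proof (rule ccontr)
        assume "\<not> f j x1 < 0"
        moreover have "\<not> f j x1 > 0" using insert.prems(3) x1 by blast
        ultimately have "f j x1 = 0" by simp
        then show False using infeasible x1 unfolding K'_def by blast
      qed
      \<comment> \<open>On \<open>K\<close>, \<open>g\<close> is the multiple \<open>- d\<close> of \<open>f j\<close>; evaluation at \<open>x1\<close> determines \<open>d\<close>.\<close>
      define d where "d = - (g x1 / f j x1)"
      have d: "d > 0" using g_pos fj by (simp add: d_def divide_pos_neg)
      have "d * f j x + g x = 0" if "x \<in> K" for x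
      proof -
        define s where "s = f j x / f j x1"
        have "x - s *\<^sub>R x1 \<in> K'"
          using that x1(1) insert.prems(1) fj
          by (auto simp: K'_def s_def subspace_diff subspace_scale linear_diff[OF lin_j]
              linear_scale[OF lin_j])
        then have "g (x - s *\<^sub>R x1) = 0" using c(3) by (simp add: g_def)
        moreover have "g (x - s *\<^sub>R x1) = g x - s * g x1"
        proof -
          have "f i (x - s *\<^sub>R x1) = f i x - s * f i x1" if "i \<in> I" for i
            using lin[of i] that by (simp add: linear_diff linear_scale)
          then have "g (x - s *\<^sub>R x1) = (\<Sum>i\<in>I. c i * f i x - s * (c i * f i x1))"
            unfolding g_def by (intro sum.cong) (simp_all add: right_diff_distrib mult.left_commute)
          then show ?thesis unfolding g_def by (simp add: sum_subtractf sum_distrib_left)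
        qed
        ultimately show ?thesis by (simp add: d_def s_def)
      qed
      then show ?thesis
        using c(1,2) d insert.hyps(2) unfolding g_def
        by (intro exI[of _ "\<lambda>i. if i = j then d else c i"]) (auto simp: extend simp del: sum.insert)
    qed
  qed
qed

text \<open>
  Only the first component of a finite supremum is attained pointwise, since it is a real-valued
  function. In an arbitrary second component one knows just that \<open>z\<close> is an upper bound, which is
  the direction that transferring inequalities requires.
\<close>

lemma finite_sups_attained:
  fixes L :: "(('x \<Rightarrow> real) \<times> 'w::vector_lattice) set"
  assumes "z \<in> finite_sups L"
  shows "\<exists>B\<subseteq>L. finite B \<and> (\<forall>b\<in>B. b \<le> z) \<and> (\<forall>\<xi>. \<exists>b\<in>B. fst z \<xi> = fst b \<xi>)"
  using assms
proof induction
  case (base x)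
  then show ?case by (intro exI[of _ "{x}"]) auto
next
  case (sup x y)
  then obtain B C where B: "B \<subseteq> L" "finite B" "\<forall>b\<in>B. b \<le> x" "\<forall>\<xi>. \<exists>b\<in>B. fst x \<xi> = fst b \<xi>"
    and C: "C \<subseteq> L" "finite C" "\<forall>b\<in>C. b \<le> y" "\<forall>\<xi>. \<exists>b\<in>C. fst y \<xi> = fst b \<xi>"
    by metis
  have "\<exists>b\<in>B \<union> C. fst (sup x y) \<xi> = fst b \<xi>" for \<xi>
  proof (cases "fst x \<xi> \<le> fst y \<xi>")
    case True
    then have "fst (sup x y) \<xi> = fst y \<xi>" by (simp add: sup_fun_def sup_absorb2)
    then show ?thesis using C(4) by auto
  next
    case False
    then have "fst (sup x y) \<xi> = fst x \<xi>" by (simp add: sup_fun_def sup_absorb1)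
    then show ?thesis using B(4) by auto
  qed
  moreover have "\<forall>b\<in>B \<union> C. b \<le> sup x y" using B(3) C(3) by (auto intro: le_supI1 le_supI2)
  ultimately show ?case using B(1,2) C(1,2) by (intro exI[of _ "B \<union> C"]) auto
qed

context
  fixes L :: "(('x::real_vector \<Rightarrow> real) \<times> 'w::vector_lattice) set"
  assumes L: "subspace L"
    and lin: "\<And>p. p \<in> L \<Longrightarrow> linear (fst p)"
    and single: "\<And>y. (0, y) \<in> L \<Longrightarrow> y = 0"
begin

text \<open>
  If \<open>l \<le> sup b\<^sub>j\<close> holds pointwise, then the functionals \<open>l - b\<^sub>j\<close> are nowhere simultaneously positive.
  Gordan's alternative gives weights with \<open>\<Sum> c\<^sub>j (l - b\<^sub>j) = 0\<close> in the first component. Since \<open>L\<close> is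
  single valued, the same relation holds in the second component, where \<open>b\<^sub>j \<le> z\<close> yields the claim.
\<close>

lemma linear_le_finite_sups_transfer:
  assumes l: "l \<in> L" and z: "z \<in> finite_sups L" and le: "fst l \<le> fst z"
  shows "snd l \<le> snd z"
proof -
  obtain B where B: "B \<subseteq> L" "finite B" "\<And>b. b \<in> B \<Longrightarrow> b \<le> z" "\<And>\<xi>. \<exists>b\<in>B. fst z \<xi> = fst b \<xi>"
    using finite_sups_attained[OF z] by metis
  define f where "f b \<xi> = fst (l - b) \<xi>" for b \<xi>
  have "\<not> (\<exists>\<xi>\<in>UNIV. \<forall>b\<in>B. f b \<xi> > 0)"
  proof
    assume "\<exists>\<xi>\<in>UNIV. \<forall>b\<in>B. f b \<xi> > 0"
    then obtain \<xi> where *: "\<forall>b\<in>B. f b \<xi> > 0" by blast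
    obtain b where "b \<in> B" "fst z \<xi> = fst b \<xi>" using B(4) by blast
    with * have "fst z \<xi> < fst l \<xi>" by (force simp: f_def)
    then show False using le_funD[OF le, of \<xi>] by simp
  qed
  moreover have "linear (f b)" if "b \<in> B" for b
    unfolding f_def using lin subspace_diff[OF L l, of b] B(1) that by blast
  ultimately obtain c where c: "\<forall>b\<in>B. c b \<ge> 0" "\<exists>b\<in>B. c b > 0" "\<forall>\<xi>. (\<Sum>b\<in>B. c b * f b \<xi>) = 0"
    using gordan_alternative[OF B(2) subspace_UNIV, of f] by auto
  define p where "p = (\<Sum>b\<in>B. c b *\<^sub>R (l - b))"
  have "p \<in> L"
    unfolding p_def using B(1) l by (intro subspace_sum[OF L] subspace_scale[OF L] subspace_diff[OF L]) auto
  moreover have "fst p = 0"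
  proof
    fix \<xi>
    have "fst p \<xi> = (\<Sum>b\<in>B. c b * f b \<xi>)"
      unfolding p_def fst_sum using B(2)
      by (induction rule: finite_induct) (auto simp: f_def scaleR_fun_def)
    then show "fst p \<xi> = 0 \<xi>" using c(3) by simp
  qed
  ultimately have "snd p = 0" using single[of "snd p"] by (metis prod.collapse)
  then have eq: "(\<Sum>b\<in>B. c b *\<^sub>R (snd l - snd b)) = 0" unfolding p_def snd_sum by simp
  define C where "C = (\<Sum>b\<in>B. c b)"
  have C: "C > 0" unfolding C_def using c(1,2) B(2) sum_pos2[of B _ c] by auto
  have "C *\<^sub>R (snd l - snd z) = (\<Sum>b\<in>B. c b *\<^sub>R (snd l - snd z))"
    unfolding C_def scaleR_left.sum ..
  also have "\<dots> \<le> (\<Sum>b\<in>B. c b *\<^sub>R (snd l - snd b))"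
    using c(1) B(3) by (intro sum_mono scaleR_left_mono diff_left_mono) (auto simp: less_eq_prod_def)
  finally have "inverse C *\<^sub>R (C *\<^sub>R (snd l - snd z)) \<le> inverse C *\<^sub>R 0"
    using C unfolding eq by (intro scaleR_left_mono) auto
  then show ?thesis using C by simp
qed

lemma finite_sups_le_transfer:
  assumes "x \<in> finite_sups L" "z \<in> finite_sups L" "fst x \<le> fst z"
  shows "snd x \<le> snd z"
  using assms(1,3) by induction (auto intro: linear_le_finite_sups_transfer[OF _ assms(2)])

lemma lattice_span_single_valued:
  assumes "(0, y) \<in> lattice_span L"
  shows "y = 0"
proof -
  obtain a b where ab: "a \<in> finite_sups L" "b \<in> finite_sups L" "(0, y) = a - b"
    using assms unfolding lattice_span_def by blast
  then have "fst a = fst b" "y = snd a - snd b"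
    by (metis eq_iff_diff_eq_0 fst_conv fst_diff, metis snd_conv snd_diff)
  then show ?thesis
    using finite_sups_le_transfer[OF ab(1,2)] finite_sups_le_transfer[OF ab(2,1)]
    by (simp add: order_antisym)
qed

end

section \<open>Graphs of partial homomorphisms and their closures\<close>

text \<open>
  One step of r-closure, in which the regulator is required to belong to \<open>G\<close> itself. For a graph
  \<open>G\<close> this bounds the errors in both components by one pair of corresponding elements.
\<close>

definition r_closure :: "'v::vector_lattice set \<Rightarrow> 'v set \<Rightarrow> 'v set" where
  "r_closure G V =
     {z \<in> V. \<exists>w\<in>G. \<forall>k::nat. k > 0 \<longrightarrow> (\<exists>p\<in>G. modulus (z - p) \<le> (1 / real k) *\<^sub>R w)}"

lemma subset_r_closure:
  assumes "vector_sublattice G" "G \<subseteq> V"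
  shows "G \<subseteq> r_closure G V"
proof
  fix z assume z: "z \<in> G"
  have "\<exists>p\<in>G. modulus (z - p) \<le> (1 / real k) *\<^sub>R 0" for k
    using z by (intro bexI[of _ z]) (simp_all add: modulus_def)
  then show "z \<in> r_closure G V"
    using z assms vector_sublattice_closed(1)[OF assms(1)] unfolding r_closure_def by blast
qed

lemma vector_sublattice_r_closure:
  assumes G: "vector_sublattice G" and V: "vector_sublattice V"
  shows "vector_sublattice (r_closure G V)"
proof -
  note Gc = vector_sublattice_closed[OF G] and Vc = vector_sublattice_closed[OF V]
  \<comment> \<open>Addition and supremum share one estimate, so both closure properties follow together.\<close>
  have combine: "h z z' \<in> r_closure G V"
    if z: "z \<in> r_closure G V" "z' \<in> r_closure G V"
      and hV: "\<And>x y. x \<in> V \<Longrightarrow> y \<in> V \<Longrightarrow> h x y \<in> V"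
      and hG: "\<And>x y. x \<in> G \<Longrightarrow> y \<in> G \<Longrightarrow> h x y \<in> G"
      and h: "\<And>x y x' y'. modulus (h x y - h x' y') \<le> modulus (x - x') + modulus (y - y')"
    for h z z'
  proof -
    obtain w w' where w: "w \<in> G" "w' \<in> G"
      and wk: "\<And>k::nat. k > 0 \<Longrightarrow> \<exists>p\<in>G. modulus (z - p) \<le> (1 / real k) *\<^sub>R w"
      and wk': "\<And>k::nat. k > 0 \<Longrightarrow> \<exists>p\<in>G. modulus (z' - p) \<le> (1 / real k) *\<^sub>R w'"
      using z unfolding r_closure_def by blast
    have "\<exists>p\<in>G. modulus (h z z' - p) \<le> (1 / real k) *\<^sub>R (w + w')" if k: "k > 0" for k :: nat
    proof -
      obtain p p' where p: "p \<in> G" "p' \<in> G"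
        "modulus (z - p) \<le> (1 / real k) *\<^sub>R w" "modulus (z' - p') \<le> (1 / real k) *\<^sub>R w'"
        using wk[OF k] wk'[OF k] by blast
      have "modulus (h z z' - h p p') \<le> (1 / real k) *\<^sub>R (w + w')"
        unfolding scaleR_add_right by (rule order_trans[OF h add_mono[OF p(3,4)]])
      then show ?thesis using hG[OF p(1,2)] by blast
    qed
    then show ?thesis using z hV Gc(2)[OF w] unfolding r_closure_def by blast
  qed
  show ?thesis
  proof (intro vector_sublatticeI subspaceI)
    have "\<exists>p\<in>G. modulus (0 - p) \<le> (1 / real k) *\<^sub>R 0" for k
      using Gc(1) by (intro bexI[of _ 0]) (simp_all add: modulus_def)
    then show "0 \<in> r_closure G V" using Gc(1) Vc(1) unfolding r_closure_def by blast
  next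
    fix x y assume "x \<in> r_closure G V" "y \<in> r_closure G V"
    then show "x + y \<in> r_closure G V"
      by (rule combine) (blast intro: Gc(2) Vc(2) modulus_add_diff_le)+
  next
    fix x y assume "x \<in> r_closure G V" "y \<in> r_closure G V"
    then show "sup x y \<in> r_closure G V"
      by (rule combine) (blast intro: Gc(6) Vc(6) modulus_sup_diff_le)+
  next
    fix c x assume x: "x \<in> r_closure G V"
    then obtain w where w: "w \<in> G"
      and wk: "\<And>k::nat. k > 0 \<Longrightarrow> \<exists>p\<in>G. modulus (x - p) \<le> (1 / real k) *\<^sub>R w"
      unfolding r_closure_def by blast
    have "\<exists>p\<in>G. modulus (c *\<^sub>R x - p) \<le> (1 / real k) *\<^sub>R (\<bar>c\<bar> *\<^sub>R w)" if "k > 0" for k :: nat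
    proof -
      obtain p where p: "p \<in> G" "modulus (x - p) \<le> (1 / real k) *\<^sub>R w" using wk \<open>k > 0\<close> by blast
      have "modulus (c *\<^sub>R x - c *\<^sub>R p) \<le> (1 / real k) *\<^sub>R (\<bar>c\<bar> *\<^sub>R w)"
        using modulus_scaleR_le[OF p(2), of c] by (simp add: scaleR_diff_right mult.commute)
      then show ?thesis using Gc(5)[OF p(1)] by blast
    qed
    then show "c *\<^sub>R x \<in> r_closure G V"
      using x Vc(5) Gc(5)[OF w] unfolding r_closure_def by blast
  qed
qed

text \<open>
  Graphs of Riesz homomorphisms from a sublattice of \<open>V\<close> to \<open>E\<close>: for a vector sublattice \<open>G\<close> of the
  product, having trivial fibre over \<open>0\<close> already makes \<open>G\<close> single valued and order preserving.
\<close>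

definition hom_graph ::
  "'v::vector_lattice set \<Rightarrow> 'w::vector_lattice set \<Rightarrow> ('v \<times> 'w) set \<Rightarrow> bool" where
  "hom_graph V E G \<longleftrightarrow>
     vector_sublattice G \<and> G \<subseteq> V \<times> E \<and> (\<forall>y. (0, y) \<in> G \<longrightarrow> y = 0)"

context
  fixes V :: "'v::vector_lattice set" and E :: "'w::vector_lattice set" and G
  assumes G: "hom_graph V E G"
begin

lemma hom_graph_sublattice: "vector_sublattice G"
  using G by (simp add: hom_graph_def)

lemma hom_graph_subset: "(x, y) \<in> G \<Longrightarrow> x \<in> V \<and> y \<in> E"
  using G by (auto simp: hom_graph_def)

lemma hom_graph_closed:
  assumes "(x, y) \<in> G" "(x', y') \<in> G"
  shows "(x + x', y + y') \<in> G" "(x - x', y - y') \<in> G" "(sup x x', sup y y') \<in> G"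
    "(inf x x', inf y y') \<in> G"
  using vector_sublattice_closed(2,3,6,7)[OF hom_graph_sublattice assms]
  by (simp_all add: sup_prod_def inf_prod_def)

lemma hom_graph_scaleR: "(x, y) \<in> G \<Longrightarrow> (c *\<^sub>R x, c *\<^sub>R y) \<in> G"
  using vector_sublattice_closed(5)[OF hom_graph_sublattice] by fastforce

lemma hom_graph_modulus: "(x, y) \<in> G \<Longrightarrow> (modulus x, modulus y) \<in> G"
  using vector_sublattice_closed(8)[OF hom_graph_sublattice, of "(x, y)"]
  by (simp add: modulus_def sup_prod_def)

text \<open>
  If \<open>x \<le> x'\<close>, the positive part of \<open>(x, y) - (x', y')\<close> has first component \<open>0\<close>, hence also second
  component \<open>0\<close>.
\<close>

lemma hom_graph_mono:
  assumes "(x, y) \<in> G" "(x', y') \<in> G" "x \<le> x'"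
  shows "y \<le> y'"
proof -
  have "(0, 0) \<in> G"
    using vector_sublattice_closed(1)[OF hom_graph_sublattice] by (simp add: zero_prod_def)
  from hom_graph_closed(3)[OF hom_graph_closed(2)[OF assms(1,2)] this]
  have "(0, sup (y - y') 0) \<in> G" using assms(3) by (simp add: sup_absorb2)
  then have "sup (y - y') 0 = 0" using G by (simp add: hom_graph_def)
  then have "y - y' \<le> 0" by (metis sup_ge1)
  then show ?thesis by simp
qed

lemma hom_graph_functional: "(x, y) \<in> G \<Longrightarrow> (x, y') \<in> G \<Longrightarrow> y = y'"
  by (meson hom_graph_mono order_antisym order_refl)

lemma hom_graph_domain: "vector_sublattice (fst ` G)"
proof (intro vector_sublatticeI)
  show "subspace (fst ` G)"
    by (intro linear_subspace_image vector_sublattice_subspace hom_graph_sublattice linear_fst)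
  fix x y assume "x \<in> fst ` G" "y \<in> fst ` G"
  then show "sup x y \<in> fst ` G" using hom_graph_closed(3) by force
qed

text \<open>
  If \<open>(0, y)\<close> is approximated by \<open>(a, b)\<close> up to \<open>(w, w') / k\<close>, then \<open>\<bar>a\<bar> \<le> w / k\<close> transfers to
  \<open>\<bar>b\<bar> \<le> w' / k\<close>, so \<open>\<bar>y\<bar> \<le> 2 w' / k\<close> for every \<open>k\<close>.
\<close>

lemma hom_graph_r_closure:
  assumes V: "vector_sublattice V" and E: "vector_sublattice E" "archimedean E"
  shows "hom_graph V E (r_closure G (V \<times> E))"
  unfolding hom_graph_def
proof (intro conjI allI impI)
  show "vector_sublattice (r_closure G (V \<times> E))"
    by (intro vector_sublattice_r_closure hom_graph_sublattice vector_sublattice_Times V E)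
  show "r_closure G (V \<times> E) \<subseteq> V \<times> E" by (auto simp: r_closure_def)
  fix y assume "(0, y) \<in> r_closure G (V \<times> E)"
  then obtain w w' where y: "y \<in> E" and w: "(w, w') \<in> G"
    and approx: "\<And>k::nat. k > 0 \<Longrightarrow> \<exists>p\<in>G. modulus ((0, y) - p) \<le> (1 / real k) *\<^sub>R (w, w')"
    unfolding r_closure_def by auto
  have "modulus y \<le> (1 / real k) *\<^sub>R (2 *\<^sub>R w')" if k: "k > 0" for k :: nat
  proof -
    obtain a b where p: "(a, b) \<in> G" "modulus ((0, y) - (a, b)) \<le> (1 / real k) *\<^sub>R (w, w')"
      using approx[OF k] by force
    then have a: "modulus a \<le> (1 / real k) *\<^sub>R w" and b: "modulus (y - b) \<le> (1 / real k) *\<^sub>R w'"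
      by (auto simp: less_eq_prod_def modulus_fst modulus_snd modulus_minus_commute[of 0 a, simplified])
    have "modulus b \<le> (1 / real k) *\<^sub>R w'"
      using hom_graph_mono[OF hom_graph_modulus[OF p(1)] hom_graph_scaleR[OF w] a] .
    then have "modulus (y - b) + modulus b \<le> (1 / real k) *\<^sub>R w' + (1 / real k) *\<^sub>R w'"
      using b by (intro add_mono)
    then have "modulus y \<le> (1 / real k) *\<^sub>R w' + (1 / real k) *\<^sub>R w'"
      using modulus_triangle[of "y - b" b] by simp
    also have "\<dots> = (1 / real k) *\<^sub>R (2 *\<^sub>R w')" by (simp add: scaleR_2 scaleR_add_right)
    finally show ?thesis .
  qed
  then show "y = 0"
    using hom_graph_subset[OF w] y vector_sublattice_closed(5)[OF E(1)]
    by (intro archimedean_modulus_eq_0[OF E(2,1), of y "2 *\<^sub>R w'"]) auto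
qed

lemma hom_graph_maximal_extension:
  shows "\<exists>M. hom_graph V E M \<and> G \<subseteq> M \<and> (\<forall>G'. hom_graph V E G' \<longrightarrow> M \<subseteq> G' \<longrightarrow> G' = M)"
proof -
  have "\<exists>M\<in>{M. hom_graph V E M \<and> G \<subseteq> M}. \<forall>X\<in>{M. hom_graph V E M \<and> G \<subseteq> M}. M \<subseteq> X \<longrightarrow> X = M"
  proof (rule subset_Zorn_nonempty)
    show "{M. hom_graph V E M \<and> G \<subseteq> M} \<noteq> {}" using G by blast
  next
    fix \<C> assume ne: "\<C> \<noteq> {}" and chain: "subset.chain {M. hom_graph V E M \<and> G \<subseteq> M} \<C>"
    have graphs: "\<And>X. X \<in> \<C> \<Longrightarrow> hom_graph V E X" "\<And>X. X \<in> \<C> \<Longrightarrow> G \<subseteq> X"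
      using chain unfolding subset.chain_def by blast+
    have latt: "\<And>X. X \<in> \<C> \<Longrightarrow> vector_sublattice X" using graphs by (simp add: hom_graph_def)
    have common: "\<exists>X\<in>\<C>. p \<in> X \<and> p' \<in> X" if "p \<in> \<Union>\<C>" "p' \<in> \<Union>\<C>" for p p'
      using that chain unfolding subset.chain_def by blast
    have "vector_sublattice (\<Union>\<C>)"
    proof (intro vector_sublatticeI subspaceI)
      show "0 \<in> \<Union>\<C>" using ne latt vector_sublattice_closed(1) by blast
    next
      fix x y assume "x \<in> \<Union>\<C>" "y \<in> \<Union>\<C>"
      then show "x + y \<in> \<Union>\<C>" using common latt vector_sublattice_closed(2) by blast
    next
      fix x y assume "x \<in> \<Union>\<C>" "y \<in> \<Union>\<C>"
      then show "sup x y \<in> \<Union>\<C>" using common latt vector_sublattice_closed(6) by blast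
    next
      fix c x assume "x \<in> \<Union>\<C>"
      then show "c *\<^sub>R x \<in> \<Union>\<C>" using latt vector_sublattice_closed(5) by blast
    qed
    moreover have "\<Union>\<C> \<subseteq> V \<times> E" "\<forall>y. (0, y) \<in> \<Union>\<C> \<longrightarrow> y = 0"
      using graphs(1) unfolding hom_graph_def by blast+
    moreover have "G \<subseteq> \<Union>\<C>" using graphs(2) ne by blast
    ultimately show "\<Union>\<C> \<in> {M. hom_graph V E M \<and> G \<subseteq> M}" unfolding hom_graph_def by blast
  qed
  then obtain M where M: "hom_graph V E M" "G \<subseteq> M"
    and max: "\<And>X. hom_graph V E X \<Longrightarrow> G \<subseteq> X \<Longrightarrow> M \<subseteq> X \<Longrightarrow> X = M"
    by auto
  have "X = M" if "hom_graph V E X" "M \<subseteq> X" for X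
    using max[OF that(1) _ that(2)] M(2) that(2) by (meson order_trans)
  then show ?thesis using M by blast
qed

end

text \<open>
  Uniform completeness provides a limit with some regulator \<open>v\<close>, which may be unrelated to \<open>w\<close>. The
  Archimedean property recovers \<open>w\<close> itself as a regulator: in
  \<open>\<bar>y n - l\<bar> \<le> \<bar>y n - y m\<bar> + \<bar>y m - l\<bar> \<le> w / k + \<bar>v\<bar> / j\<close> the last term can be made to disappear.
\<close>

lemma UCVL_sequence_limit:
  fixes E :: "'v::vector_lattice set"
  assumes E: "UCVL E" and y: "\<And>n::nat. y n \<in> E" and w: "w \<in> E" "0 \<le> w"
    and cauchy: "\<And>k::nat. k > 0 \<Longrightarrow>
      \<exists>N. \<forall>n\<ge>N. \<forall>m\<ge>N. modulus (y n - y m) \<le> (1 / real k) *\<^sub>R w"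
  shows "\<exists>l\<in>E. \<forall>k::nat. k > 0 \<longrightarrow> (\<exists>N. \<forall>n\<ge>N. modulus (y n - l) \<le> (1 / real k) *\<^sub>R w)"
proof -
  have latt: "vector_sublattice E" and arch: "archimedean E" and uc: "uniformly_complete E"
    using E by (auto simp: UCVL_def)
  note Ec = vector_sublattice_closed[OF latt]
  let ?F = "filtermap y sequentially"
  have "?F \<noteq> bot" by (simp add: filtermap_bot_iff)
  moreover have "?F \<le> principal E" by (simp add: le_principal eventually_filtermap y)
  moreover have "r_cauchy (\<lambda>x. x) w ?F"
    unfolding r_cauchy_def
  proof (intro allI impI)
    fix k :: nat assume "k > 0"
    obtain N where N: "\<And>n m. n \<ge> N \<Longrightarrow> m \<ge> N \<Longrightarrow> modulus (y n - y m) \<le> (1 / real k) *\<^sub>R w"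
      using cauchy[OF \<open>k > 0\<close>] by auto
    have "eventually (\<lambda>x. \<exists>n\<ge>N. x = y n) ?F"
      unfolding eventually_filtermap eventually_sequentially by (intro exI[of _ N]) auto
    then show "\<forall>\<^sub>F (a, b) in ?F \<times>\<^sub>F ?F. modulus (a - b) \<le> (1 / real k) *\<^sub>R modulus w"
      unfolding eventually_prod_same modulus_of_nonneg[OF w(2)]
      using N by (intro exI[of _ "\<lambda>x. \<exists>n\<ge>N. x = y n"]) auto
  qed
  ultimately obtain l v where l: "l \<in> E" "v \<in> E" and lim: "r_converges (\<lambda>x. x) l v ?F"
    using uc w(1) unfolding uniformly_complete_def by blast
  have "\<exists>N. \<forall>n\<ge>N. modulus (y n - l) \<le> (1 / real k) *\<^sub>R w" if "k > 0" for k :: nat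
  proof -
    obtain N where N: "\<And>n m. n \<ge> N \<Longrightarrow> m \<ge> N \<Longrightarrow> modulus (y n - y m) \<le> (1 / real k) *\<^sub>R w"
      using cauchy[OF \<open>k > 0\<close>] by auto
    have "modulus (y n - l) \<le> (1 / real k) *\<^sub>R w" if n: "n \<ge> N" for n
    proof -
      have "modulus (y n - l) - (1 / real k) *\<^sub>R w \<le> (1 / real j) *\<^sub>R modulus v"
        if "j > 0" for j :: nat
      proof -
        obtain M where "\<And>m. m \<ge> M \<Longrightarrow> modulus (y m - l) \<le> (1 / real j) *\<^sub>R modulus v"
          using lim \<open>j > 0\<close>
          unfolding r_converges_def eventually_filtermap eventually_sequentially by blast
        then have m: "modulus (y (max M N) - l) \<le> (1 / real j) *\<^sub>R modulus v" by simp
        have "modulus (y n - l) \<le> modulus (y n - y (max M N)) + modulus (y (max M N) - l)"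
          by (rule modulus_triangle_diff)
        also have "\<dots> \<le> (1 / real k) *\<^sub>R w + (1 / real j) *\<^sub>R modulus v"
          using n m by (intro add_mono N) auto
        finally show ?thesis by (simp add: diff_le_eq add.commute)
      qed
      then have "modulus (y n - l) - (1 / real k) *\<^sub>R w \<le> 0"
        by (intro archimedeanD[OF arch _ Ec(8)[OF l(2)]] Ec(3,5,8) y l w)
      then show ?thesis by simp
    qed
    then show ?thesis by blast
  qed
  then show ?thesis using l(1) by blast
qed

text \<open>
  A sequence in the domain that converges with regulator \<open>u\<close> converges with a regulator \<open>w\<close> in the
  domain. Its images are then r-Cauchy with regulator the image of \<open>w\<close>, so they converge in \<open>E\<close>, and
  the pair of limits lies in the closure of the graph, with a regulator from the graph.
\<close>

lemma hom_graph_r_closed_domain: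
  assumes G: "hom_graph V E G" and closed: "r_closure G (V \<times> E) \<subseteq> G" and E: "UCVL E"
    and majorizing: "\<And>u. u \<in> V \<Longrightarrow> \<exists>w\<in>fst ` G. modulus u \<le> w"
  shows "r_closed_in (fst ` G) V"
  unfolding r_closed_in_def
proof (intro allI impI)
  fix x :: "nat \<Rightarrow> 'a" and l u
  assume "\<forall>n. x n \<in> fst ` G" and l: "l \<in> V" and u: "u \<in> V"
    and lim: "r_converges x l u sequentially"
  then have "\<forall>n. \<exists>y. (x n, y) \<in> G" by force
  then obtain y where y: "\<And>n. (x n, y n) \<in> G" by metis
  obtain w w' where w: "(w, w') \<in> G" "modulus u \<le> w" using majorizing[OF u] by force
  have "0 \<le> w" using w(2) modulus_nonneg[of u] by (rule order_trans[rotated])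
  have "(0, 0) \<in> G"
    using vector_sublattice_closed(1)[OF hom_graph_sublattice[OF G]] by (simp add: zero_prod_def)
  then have w'0: "0 \<le> w'" using hom_graph_mono[OF G _ w(1) \<open>0 \<le> w\<close>] by blast
  have tail: "\<exists>N. \<forall>n\<ge>N. modulus (x n - l) \<le> (1 / real k) *\<^sub>R w" if k: "k > 0" for k :: nat
  proof -
    have "(1 / real k) *\<^sub>R modulus u \<le> (1 / real k) *\<^sub>R w"
      using w(2) by (intro scaleR_left_mono) auto
    then show ?thesis
      using lim k unfolding r_converges_def eventually_sequentially by (meson order_trans)
  qed
  have "\<exists>N. \<forall>n\<ge>N. \<forall>m\<ge>N. modulus (y n - y m) \<le> (1 / real k) *\<^sub>R w'" if "k > 0" for k :: nat
  proof -
    obtain N where N: "\<And>n. n \<ge> N \<Longrightarrow> modulus (x n - l) \<le> (1 / real (2 * k)) *\<^sub>R w"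
      using tail[of "2 * k"] \<open>k > 0\<close> by auto
    have "modulus (y n - y m) \<le> (1 / real k) *\<^sub>R w'" if "n \<ge> N" "m \<ge> N" for n m
    proof -
      have "modulus (x n - x m) \<le> modulus (x n - l) + modulus (l - x m)"
        by (rule modulus_triangle_diff)
      also have "\<dots> \<le> (1 / real (2 * k)) *\<^sub>R w + (1 / real (2 * k)) *\<^sub>R w"
        using that by (subst modulus_minus_commute[of l]) (intro add_mono N)
      also have "\<dots> = (1 / real k) *\<^sub>R w" by (simp add: scaleR_left_distrib[symmetric] add_divide_distrib[symmetric])
      finally show ?thesis
        using hom_graph_mono[OF G hom_graph_modulus[OF G hom_graph_closed(2)[OF G y y]]
            hom_graph_scaleR[OF G w(1)]] by blast
    qed
    then show ?thesis by blast
  qed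
  then obtain l' where l': "l' \<in> E"
    and lim': "\<And>k::nat. k > 0 \<Longrightarrow> \<exists>N. \<forall>n\<ge>N. modulus (y n - l') \<le> (1 / real k) *\<^sub>R w'"
    using UCVL_sequence_limit[OF E, of y w'] hom_graph_subset[OF G y] hom_graph_subset[OF G w(1)] w'0
    by blast
  have "\<exists>p\<in>G. modulus ((l, l') - p) \<le> (1 / real k) *\<^sub>R (w, w')" if k: "k > 0" for k :: nat
  proof -
    obtain N N' where "\<forall>n\<ge>N. modulus (x n - l) \<le> (1 / real k) *\<^sub>R w"
      "\<forall>n\<ge>N'. modulus (y n - l') \<le> (1 / real k) *\<^sub>R w'"
      using tail[OF k] lim'[OF k] by blast
    then have "modulus (x (max N N') - l) \<le> (1 / real k) *\<^sub>R w"
      "modulus (y (max N N') - l') \<le> (1 / real k) *\<^sub>R w'" by simp_all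
    then have "modulus ((l, l') - (x (max N N'), y (max N N'))) \<le> (1 / real k) *\<^sub>R (w, w')"
      by (simp add: less_eq_prod_def modulus_fst modulus_snd modulus_minus_commute[of l]
          modulus_minus_commute[of l'])
    then show ?thesis using y by blast
  qed
  then have "(l, l') \<in> r_closure G (V \<times> E)" using l l' w(1) unfolding r_closure_def by blast
  then show "l \<in> fst ` G" using closed by force
qed

section \<open>The positively homogeneous continuous functions\<close>

lemma real_archimedean_le_0:
  fixes x c :: real
  assumes "\<And>k::nat. k > 0 \<Longrightarrow> x \<le> (1 / real k) * c"
  shows "x \<le> 0"
proof (rule ccontr)
  assume x: "\<not> x \<le> 0"
  obtain k :: nat where k: "c / x < real k" using reals_Archimedean2 by blast
  then have "c < real k * x" using x by (simp add: field_simps)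
  also have "\<dots> < real (Suc k) * x" using x by simp
  finally have "(1 / real (Suc k)) * c < x" by (simp add: field_simps)
  then show False using assms[of "Suc k"] by simp
qed

lemma H_continuous: "h \<in> H \<Longrightarrow> continuous_on UNIV h"
  and H_homogeneous: "h \<in> H \<Longrightarrow> 0 \<le> t \<Longrightarrow> h (t *\<^sub>R \<xi>) = t * h \<xi>"
  by (simp_all add: H_def)

lemma vector_sublattice_H: "vector_sublattice (H :: (('a \<Rightarrow> real) \<Rightarrow> real) set)"
proof (intro vector_sublatticeI subspaceI)
  show "(0 :: ('a \<Rightarrow> real) \<Rightarrow> real) \<in> H" by (simp add: H_def func_zero)
next
  fix x y :: "('a \<Rightarrow> real) \<Rightarrow> real" assume "x \<in> H" "y \<in> H"
  then show "x + y \<in> H" by (auto simp: H_def func_plus distrib_left intro: continuous_on_add)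
next
  fix x y :: "('a \<Rightarrow> real) \<Rightarrow> real" assume "x \<in> H" "y \<in> H"
  then show "sup x y \<in> H"
    by (auto simp: H_def sup_fun_def sup_real_def max_mult_distrib_left intro: continuous_on_max)
next
  fix c and x :: "('a \<Rightarrow> real) \<Rightarrow> real" assume "x \<in> H"
  then show "c *\<^sub>R x \<in> H"
    by (auto simp: H_def scaleR_fun_def intro: continuous_on_mult_left)
qed

lemma \<delta>_in_H: "\<delta> a \<in> H"
  by (simp add: H_def \<delta>_def[abs_def] scaleR_fun_def)

lemma FVL_sublattice: "vector_sublattice (FVL :: (('a \<Rightarrow> real) \<Rightarrow> real) set)"
  unfolding FVL_def by (rule vector_sublattice_Inter) blast

lemma \<delta>_in_FVL: "\<delta> a \<in> FVL"
  unfolding FVL_def by blast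

lemma FVL_least: "vector_sublattice W \<Longrightarrow> W \<subseteq> H \<Longrightarrow> range \<delta> \<subseteq> W \<Longrightarrow> FVL \<subseteq> W"
  unfolding FVL_def by blast

text \<open>
  On a basic neighbourhood of \<open>0\<close>, given by \<open>\<bar>\<xi> a\<bar> < e a\<close> for \<open>a\<close> in a finite set \<open>S\<close>, one has
  \<open>\<bar>h \<xi>\<bar> < 1\<close>. The function \<open>w = \<Sum>a\<in>S. \<bar>\<delta> a\<bar> / e a\<close> is chosen such that \<open>w \<xi> < 1\<close> puts \<open>\<xi>\<close> into this
  neighbourhood, and scaling by \<open>1 / s\<close> for \<open>s > w \<xi>\<close> gives \<open>\<bar>h \<xi>\<bar> < s\<close>.
\<close>

lemma FVL_majorizes_H:
  fixes h :: "('a \<Rightarrow> real) \<Rightarrow> real"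
  assumes h: "h \<in> H"
  shows "\<exists>w\<in>FVL. modulus h \<le> w"
proof -
  have h0: "h 0 = 0" using H_homogeneous[OF h, of 0 0] by simp
  have "open (h -` {-1<..<1})"
    using H_continuous[OF h] by (intro open_vimage) auto
  moreover have "0 \<in> h -` {-1<..<1}" using h0 by simp
  ultimately have "\<exists>X. 0 \<in> Pi\<^sub>E UNIV X \<and> (\<forall>a. open (X a)) \<and> finite {a. X a \<noteq> UNIV} \<and>
      Pi\<^sub>E UNIV X \<subseteq> h -` {-1<..<1}"
    using product_topology_open_contains_basis[of "\<lambda>_. euclidean" UNIV "h -` {-1<..<1}" 0]
    unfolding open_fun_def by simp
  then obtain X :: "'a \<Rightarrow> real set" where X: "0 \<in> Pi\<^sub>E UNIV X" "\<And>a. open (X a)"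
    and fin: "finite {a. X a \<noteq> UNIV}" and sub: "Pi\<^sub>E UNIV X \<subseteq> h -` {-1<..<1}"
    by blast
  define S where "S = {a. X a \<noteq> UNIV}"
  have "\<exists>e>0. ball 0 e \<subseteq> X a" for a
  proof -
    have "0 \<in> X a" using X(1) PiE_mem[of 0 UNIV X a] by simp
    then show ?thesis using X(2)[of a] by (auto simp: open_contains_ball)
  qed
  then obtain e where e: "\<And>a. e a > 0" "\<And>a. ball 0 (e a) \<subseteq> X a" by metis
  define w where "w = (\<Sum>a\<in>S. (1 / e a) *\<^sub>R modulus (\<delta> a))"
  have w_apply: "w \<xi> = (\<Sum>a\<in>S. \<bar>\<xi> a\<bar> / e a)" for \<xi>
    using fin unfolding w_def S_def[symmetric]
    by (induction rule: finite_induct) (simp_all add: scaleR_fun_def modulus_apply \<delta>_def)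
  have w_nonneg: "0 \<le> w \<xi>" for \<xi>
    unfolding w_apply using e(1) by (intro sum_nonneg) (simp add: less_imp_le)
  have small: "\<bar>h \<xi>\<bar> < 1" if "w \<xi> < 1" for \<xi>
  proof -
    have "\<xi> a \<in> X a" for a
    proof (cases "a \<in> S")
      case True
      have "\<bar>\<xi> a\<bar> / e a \<le> w \<xi>"
        unfolding w_apply using fin e(1) True
        by (intro member_le_sum) (auto simp: S_def less_imp_le)
      then have "\<bar>\<xi> a\<bar> / e a < 1" using that by linarith
      then have "\<bar>\<xi> a\<bar> < e a" using e(1)[of a] by (simp add: field_simps)
      then show ?thesis using e(2)[of a] by (auto simp: dist_real_def)
    qed (simp add: S_def)
    then have "\<xi> \<in> Pi\<^sub>E UNIV X" by (simp add: PiE_iff)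
    then show ?thesis using sub by force
  qed
  have "\<bar>h \<xi>\<bar> \<le> w \<xi>" for \<xi>
  proof (rule dense_ge)
    fix s assume s: "w \<xi> < s"
    then have "s > 0" using w_nonneg[of \<xi>] by simp
    have "w ((1 / s) *\<^sub>R \<xi>) = w \<xi> / s"
      using \<open>s > 0\<close> unfolding w_apply
      by (simp add: scaleR_fun_def abs_mult sum_divide_distrib field_simps)
    then have "\<bar>h ((1 / s) *\<^sub>R \<xi>)\<bar> < 1" using s \<open>s > 0\<close> by (intro small) simp
    then show "\<bar>h \<xi>\<bar> \<le> s"
      using H_homogeneous[OF h, of "1 / s" \<xi>] \<open>s > 0\<close> by (simp add: field_simps abs_mult)
  qed
  then have "modulus h \<le> w" by (simp add: le_fun_def modulus_apply)
  moreover have "w \<in> FVL"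
    unfolding w_def
    by (intro subspace_sum vector_sublattice_subspace vector_sublattice_closed(5,8) FVL_sublattice
        \<delta>_in_FVL)
  ultimately show ?thesis by blast
qed

text \<open>
  A continuous \<open>u\<close> is locally bounded, so approximation regulated by \<open>u\<close> is locally uniform and
  continuity passes to the limit. Homogeneity passes to the limit pointwise.
\<close>

lemma H_regulated_limit:
  fixes l :: "('a \<Rightarrow> real) \<Rightarrow> real"
  assumes u: "u \<in> H"
    and approx: "\<And>k::nat. k > 0 \<Longrightarrow> \<exists>x\<in>H. modulus (x - l) \<le> (1 / real k) *\<^sub>R modulus u"
  shows "l \<in> H"
proof -
  have approx': "\<exists>x\<in>H. \<forall>\<xi>. \<bar>x \<xi> - l \<xi>\<bar> \<le> (1 / real k) * \<bar>u \<xi>\<bar>" if k: "k > 0" for k :: nat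
    using approx[OF k] by (auto simp: le_fun_def modulus_apply scaleR_fun_def)
  have "(l \<longlongrightarrow> l \<xi>) (at \<xi>)" for \<xi>
    unfolding tendsto_iff
  proof (intro allI impI)
    fix e :: real assume e: "e > 0"
    obtain k :: nat where k0: "3 * (\<bar>u \<xi>\<bar> + 1) / e < real k" using reals_Archimedean2 by blast
    moreover have "3 * (\<bar>u \<xi>\<bar> + 1) / e > 0" using e by simp
    ultimately have k: "k > 0" by (metis of_nat_0_less_iff order_less_trans)
    have ke: "(1 / real k) * (\<bar>u \<xi>\<bar> + 1) < e / 3" using k0 k e by (simp add: field_simps)
    obtain x where x: "x \<in> H" "\<And>\<eta>. \<bar>x \<eta> - l \<eta>\<bar> \<le> (1 / real k) * \<bar>u \<eta>\<bar>"
      using approx'[OF k] by blast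
    have ux: "(u \<longlongrightarrow> u \<xi>) (at \<xi>)" "(x \<longlongrightarrow> x \<xi>) (at \<xi>)"
      using H_continuous[OF u] H_continuous[OF x(1)] by (auto simp: continuous_on_def)
    have "\<forall>\<^sub>F \<eta> in at \<xi>. dist (u \<eta>) (u \<xi>) < 1" "\<forall>\<^sub>F \<eta> in at \<xi>. dist (x \<eta>) (x \<xi>) < e / 3"
      using tendstoD[OF ux(1), of 1] tendstoD[OF ux(2), of "e / 3"] e by simp_all
    then show "\<forall>\<^sub>F \<eta> in at \<xi>. dist (l \<eta>) (l \<xi>) < e"
    proof eventually_elim
      case (elim \<eta>)
      have bound: "(1 / real k) * \<bar>u \<zeta>\<bar> < e / 3" if "\<bar>u \<zeta>\<bar> \<le> \<bar>u \<xi>\<bar> + 1" for \<zeta>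
        by (rule order_le_less_trans[OF mult_left_mono[OF that] ke]) simp
      have "\<bar>u \<eta>\<bar> \<le> \<bar>u \<xi>\<bar> + 1" using elim(1) unfolding dist_real_def by linarith
      then have "\<bar>x \<eta> - l \<eta>\<bar> < e / 3" "\<bar>x \<xi> - l \<xi>\<bar> < e / 3"
        using x(2)[of \<eta>] x(2)[of \<xi>] bound[of \<eta>] bound[of \<xi>] by linarith+
      then show ?case using elim(2) unfolding dist_real_def by linarith
    qed
  qed
  moreover have "l (t *\<^sub>R \<xi>) = t * l \<xi>" if t: "t \<ge> 0" for t \<xi>
  proof -
    have "\<bar>l (t *\<^sub>R \<xi>) - t * l \<xi>\<bar> \<le> (1 / real k) * (2 * t * \<bar>u \<xi>\<bar>)" if k: "k > 0" for k :: nat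
    proof -
      obtain x where x: "x \<in> H" "\<And>\<eta>. \<bar>x \<eta> - l \<eta>\<bar> \<le> (1 / real k) * \<bar>u \<eta>\<bar>"
        using approx'[OF k] by blast
      have 1: "\<bar>t * x \<xi> - l (t *\<^sub>R \<xi>)\<bar> \<le> (1 / real k) * (t * \<bar>u \<xi>\<bar>)"
        using x(2)[of "t *\<^sub>R \<xi>"] t H_homogeneous[OF x(1) t] H_homogeneous[OF u t]
        by (simp add: abs_mult)
      have "\<bar>t * x \<xi> - t * l \<xi>\<bar> = t * \<bar>x \<xi> - l \<xi>\<bar>"
        using t by (simp add: abs_mult right_diff_distrib[symmetric])
      also have "\<dots> \<le> t * ((1 / real k) * \<bar>u \<xi>\<bar>)" using x(2) t by (intro mult_left_mono)
      finally have 2: "\<bar>t * x \<xi> - t * l \<xi>\<bar> \<le> (1 / real k) * (t * \<bar>u \<xi>\<bar>)"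
        by (simp add: mult.left_commute)
      have "(1 / real k) * (2 * t * \<bar>u \<xi>\<bar>)
          = (1 / real k) * (t * \<bar>u \<xi>\<bar>) + (1 / real k) * (t * \<bar>u \<xi>\<bar>)"
        by (simp add: algebra_simps)
      then show ?thesis using 1 2 by linarith
    qed
    then have "\<bar>l (t *\<^sub>R \<xi>) - t * l \<xi>\<bar> \<le> 0" by (rule real_archimedean_le_0)
    then show ?thesis by simp
  qed
  ultimately show ?thesis by (simp add: H_def continuous_on_def)
qed

text \<open>
  A sequence \<open>s\<close> that eventually lies in each of countably many sets of the filter finds the
  pointwise limit; closeness to \<open>s n\<close> then passes to the limit for every function in those sets.
\<close>

lemma H_r_cauchy_limit:
  fixes G :: "(('a \<Rightarrow> real) \<Rightarrow> real) filter"
  assumes u: "u \<in> H" and G: "G \<noteq> bot" "G \<le> principal H" and cauchy: "r_cauchy (\<lambda>x. x) u G"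
  shows "\<exists>l\<in>H. r_converges (\<lambda>x. x) l u G"
proof -
  have "\<exists>Q. eventually Q G \<and> (\<forall>x y. Q x \<longrightarrow> Q y \<longrightarrow> modulus (x - y) \<le> (1 / real k) *\<^sub>R modulus u)"
    if "k > 0" for k :: nat
    using cauchy that unfolding r_cauchy_def eventually_prod_same by auto
  then obtain Q where Q: "\<And>k. k > 0 \<Longrightarrow> eventually (Q k) G"
    and close: "\<And>k x y. k > (0::nat) \<Longrightarrow> Q k x \<Longrightarrow> Q k y \<Longrightarrow>
      modulus (x - y) \<le> (1 / real k) *\<^sub>R modulus u"
    by metis
  have close': "\<bar>x \<xi> - y \<xi>\<bar> \<le> (1 / real k) * \<bar>u \<xi>\<bar>" if "k > 0" "Q k x" "Q k y" for k x y \<xi>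
    using close[OF that] by (auto simp: le_fun_def modulus_apply scaleR_fun_def)
  have inH: "eventually (\<lambda>x. x \<in> H) G" using G(2) by (simp add: le_principal)
  have "\<exists>x. \<forall>k\<in>{0<..n}. Q k x" for n
  proof -
    have "eventually (\<lambda>x. \<forall>k\<in>{0<..n}. Q k x) G" using Q by (intro eventually_ball_finite) auto
    then show ?thesis using eventually_happens'[OF G(1)] by blast
  qed
  then obtain s where s: "\<And>n k. 0 < k \<Longrightarrow> k \<le> n \<Longrightarrow> Q k (s n)"
    by (metis greaterThanAtMost_iff)
  have "Cauchy (\<lambda>n. s n \<xi>)" for \<xi>
  proof (rule metric_CauchyI)
    fix e :: real assume e: "e > 0"
    obtain k :: nat where k0: "\<bar>u \<xi>\<bar> / e < real k" using reals_Archimedean2 by blast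
    moreover have "\<bar>u \<xi>\<bar> / e \<ge> 0" using e by simp
    ultimately have k: "k > 0" by (metis of_nat_0_less_iff order_le_less_trans)
    have "dist (s m \<xi>) (s n \<xi>) < e" if "m \<ge> k" "n \<ge> k" for m n
    proof -
      have "(1 / real k) * \<bar>u \<xi>\<bar> < e" using k0 k e by (simp add: field_simps)
      then show ?thesis
        using close'[OF k s[OF k that(1)] s[OF k that(2)], of \<xi>] unfolding dist_real_def by linarith
    qed
    then show "\<exists>M. \<forall>m\<ge>M. \<forall>n\<ge>M. dist (s m \<xi>) (s n \<xi>) < e" by blast
  qed
  then have "\<exists>c. (\<lambda>n. s n \<xi>) \<longlonglongrightarrow> c" for \<xi>
    using Cauchy_convergent_iff convergent_def by blast
  then obtain l where l: "\<And>\<xi>. (\<lambda>n. s n \<xi>) \<longlonglongrightarrow> l \<xi>" by metis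
  have near: "modulus (x - l) \<le> (1 / real k) *\<^sub>R modulus u" if k: "k > 0" and x: "Q k x" for k x
  proof -
    have "\<bar>x \<xi> - l \<xi>\<bar> \<le> (1 / real k) * \<bar>u \<xi>\<bar>" for \<xi>
    proof (rule LIMSEQ_le_const2)
      show "(\<lambda>n. \<bar>x \<xi> - s n \<xi>\<bar>) \<longlonglongrightarrow> \<bar>x \<xi> - l \<xi>\<bar>" by (intro tendsto_intros l)
      show "\<exists>N. \<forall>n\<ge>N. \<bar>x \<xi> - s n \<xi>\<bar> \<le> (1 / real k) * \<bar>u \<xi>\<bar>"
        using close'[OF k x s[OF k]] by blast
    qed
    then show ?thesis by (simp add: le_fun_def modulus_apply scaleR_fun_def)
  qed
  have conv: "r_converges (\<lambda>x. x) l u G"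
    unfolding r_converges_def by (intro allI impI eventually_mono[OF Q near])
  have "\<exists>x\<in>H. modulus (x - l) \<le> (1 / real k) *\<^sub>R modulus u" if k: "k > 0" for k :: nat
    using eventually_happens'[OF G(1) eventually_conj[OF inH Q[OF k]]] near[OF k] by blast
  then have "l \<in> H" by (rule H_regulated_limit[OF u])
  then show ?thesis using conv by blast
qed

lemma UCVL_of_r_closed:
  fixes F :: "(('a \<Rightarrow> real) \<Rightarrow> real) set"
  assumes F: "vector_sublattice F" "F \<subseteq> H" "r_closed_in F H"
  shows "UCVL F"
  unfolding UCVL_def
proof (intro conjI F(1))
  show "archimedean F"
    unfolding archimedean_def
  proof (intro ballI impI)
    fix x y :: "('a \<Rightarrow> real) \<Rightarrow> real"
    assume le: "\<forall>n::nat. n > 0 \<longrightarrow> real n *\<^sub>R x \<le> y"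
    have "x \<xi> \<le> 0" for \<xi>
    proof (rule real_archimedean_le_0)
      fix k :: nat assume "k > 0"
      then show "x \<xi> \<le> (1 / real k) * y \<xi>"
        using le by (auto simp: le_fun_def scaleR_fun_def field_simps)
    qed
    then show "x \<le> 0" by (simp add: le_fun_def)
  qed
  show "uniformly_complete F"
    unfolding uniformly_complete_def
  proof (intro ballI allI impI)
    fix u and G :: "(('a \<Rightarrow> real) \<Rightarrow> real) filter"
    assume u: "u \<in> F" and G: "G \<noteq> bot" "G \<le> principal F" and cauchy: "r_cauchy (\<lambda>x. x) u G"
    have inF: "eventually (\<lambda>x. x \<in> F) G" using G(2) by (simp add: le_principal)
    have "G \<le> principal H" using G(2) F(2) by (meson order_trans principal_le_iff)
    then obtain l where l: "l \<in> H" "r_converges (\<lambda>x. x) l u G"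
      using H_r_cauchy_limit[OF _ G(1) _ cauchy] u F(2) by blast
    have "\<exists>x. x \<in> F \<and> modulus (x - l) \<le> (1 / real (Suc n)) *\<^sub>R modulus u" for n
      using l(2) eventually_happens'[OF G(1) eventually_conj[OF inF]]
      unfolding r_converges_def by blast
    then obtain x where x: "\<And>n. x n \<in> F" "\<And>n. modulus (x n - l) \<le> (1 / real (Suc n)) *\<^sub>R modulus u"
      by metis
    have "r_converges x l u sequentially"
      unfolding r_converges_def
    proof (intro allI impI)
      fix k :: nat assume k: "k > 0"
      have "modulus (x n - l) \<le> (1 / real k) *\<^sub>R modulus u" if "n \<ge> k" for n
      proof (rule order_trans[OF x(2)])
        show "(1 / real (Suc n)) *\<^sub>R modulus u \<le> (1 / real k) *\<^sub>R modulus u"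
          using k that by (intro scaleR_right_mono modulus_nonneg) (simp add: field_simps)
      qed
      then show "\<forall>\<^sub>F n in sequentially. modulus (x n - l) \<le> (1 / real k) *\<^sub>R modulus u"
        unfolding eventually_sequentially by blast
    qed
    then have "l \<in> F" using F(2,3) x(1) l(1) u unfolding r_closed_in_def by blast
    then show "\<exists>l\<in>F. \<exists>w\<in>F. r_converges (\<lambda>x. x) l w G" using l(2) u by blast
  qed
qed

section \<open>Existence and uniqueness of the extension\<close>

lemma independent_range_\<delta>: "independent (range (\<delta> :: 'a \<Rightarrow> ('a \<Rightarrow> real) \<Rightarrow> real))"
  unfolding dependent_def
proof (intro notI, elim bexE)
  fix d :: "('a \<Rightarrow> real) \<Rightarrow> real"
  assume "d \<in> range \<delta>" and span: "d \<in> span (range \<delta> - {d})"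
  then obtain a where d: "d = \<delta> a" by blast
  define e :: "'a \<Rightarrow> real" where "e b = (if b = a then 1 else 0)" for b
  have "subspace {f :: ('a \<Rightarrow> real) \<Rightarrow> real. f e = 0}"
    by (simp add: subspace_def scaleR_fun_def)
  moreover have "range \<delta> - {d} \<subseteq> {f. f e = 0}" by (auto simp: \<delta>_def e_def d)
  ultimately have "d e = 0" using span span_minimal by blast
  then show False by (simp add: d \<delta>_def e_def)
qed

lemma inj_\<delta>: "inj (\<delta> :: 'a \<Rightarrow> ('a \<Rightarrow> real) \<Rightarrow> real)"
proof (rule injI)
  fix a b :: 'a
  assume "\<delta> a = \<delta> b"
  then have "\<delta> a (\<lambda>c. if c = a then 1 else 0) = \<delta> b (\<lambda>c. if c = a then 1 else 0)" by simp
  then show "a = b" by (simp add: \<delta>_def split: if_splits)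
qed

text \<open>
  The linear span \<open>L\<close> of the generators is the graph of a linear map, because the coordinate functions
  are linearly independent, and its first components are linear functionals. Hence the
  transfer of inequalities applies to the lattice generated by \<open>L\<close>. The intersection with \<open>H \<times> E\<close>
  saves checking that this lattice lies in the product.
\<close>

lemma generated_hom_graph:
  fixes q :: "'a \<Rightarrow> 'e::vector_lattice"
  assumes E: "vector_sublattice E" "range q \<subseteq> E"
  shows "\<exists>G. hom_graph H E G \<and> (\<forall>a. (\<delta> a, q a) \<in> G)"
proof -
  define L where "L = span (range (\<lambda>a. (\<delta> a, q a)))"
  have L: "subspace L" and gen: "\<And>a. (\<delta> a, q a) \<in> L"
    unfolding L_def by (auto intro: span_base)
  have "subspace {p :: (('a \<Rightarrow> real) \<Rightarrow> real) \<times> 'e. linear (fst p)}"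
    unfolding subspace_def
    by (auto simp: linear_iff scaleR_fun_def algebra_simps)
  moreover have "linear (\<delta> a)" for a :: 'a by (simp add: linear_iff \<delta>_def scaleR_fun_def)
  ultimately have "L \<subseteq> {p. linear (fst p)}" unfolding L_def by (intro span_minimal) auto
  then have lin: "linear (fst p)" if "p \<in> L" for p using that by blast
  obtain g where g: "linear g" "\<forall>d\<in>range \<delta>. g d = (q \<circ> inv \<delta>) d"
    using linear_independent_extend[OF independent_range_\<delta>] by blast
  then have g_gen: "g (\<delta> a) = q a" for a by (simp add: inv_f_f[OF inj_\<delta>])
  have "subspace {p. snd p = g (fst p)}"
    unfolding subspace_def using g(1)
    by (auto simp: linear_add linear_scale linear_0)
  then have "L \<subseteq> {p. snd p = g (fst p)}" unfolding L_def using g_gen by (intro span_minimal) auto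
  then have single: "y = 0" if "(0, y) \<in> L" for y using that linear_0[OF g(1)] by auto
  let ?G = "lattice_span L \<inter> (H \<times> E)"
  have HE: "vector_sublattice (H \<times> E)" by (intro vector_sublattice_Times vector_sublattice_H E)
  have "hom_graph H E ?G"
    unfolding hom_graph_def
  proof (intro conjI allI impI)
    show "vector_sublattice ?G"
      using vector_sublattice_Inter[of "{lattice_span L, H \<times> E}"] vector_sublattice_lattice_span[OF L] HE
      by auto
    show "y = 0" if "(0, y) \<in> ?G" for y
      using lattice_span_single_valued[OF L lin single] that by blast
  qed auto
  moreover have "(\<delta> a, q a) \<in> ?G" for a
    using subsetD[OF subset_lattice_span[OF L] gen[of a]] \<delta>_in_H[of a] E(2) by auto
  ultimately show ?thesis by blast
qed

lemma riesz_hom_on_simps: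
  assumes T: "riesz_hom_on F T" and F: "vector_sublattice F"
  shows "x \<in> F \<Longrightarrow> y \<in> F \<Longrightarrow> T (x + y) = T x + T y"
    and "x \<in> F \<Longrightarrow> T (c *\<^sub>R x) = c *\<^sub>R T x"
    and "x \<in> F \<Longrightarrow> y \<in> F \<Longrightarrow> T (sup x y) = sup (T x) (T y)"
    and "x \<in> F \<Longrightarrow> T (- x) = - T x"
    and "x \<in> F \<Longrightarrow> y \<in> F \<Longrightarrow> T (x - y) = T x - T y"
    and "x \<in> F \<Longrightarrow> T (modulus x) = modulus (T x)"
    and "x \<in> F \<Longrightarrow> y \<in> F \<Longrightarrow> x \<le> y \<Longrightarrow> T x \<le> T y"
proof -
  note Fc = vector_sublattice_closed[OF F]
  show add: "x \<in> F \<Longrightarrow> y \<in> F \<Longrightarrow> T (x + y) = T x + T y"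
    and "x \<in> F \<Longrightarrow> T (c *\<^sub>R x) = c *\<^sub>R T x"
    and sup: "x \<in> F \<Longrightarrow> y \<in> F \<Longrightarrow> T (sup x y) = sup (T x) (T y)" for x y
    using T by (auto simp: riesz_hom_on_def)
  show neg: "T (- x) = - T x" if "x \<in> F" for x
    using T that unfolding riesz_hom_on_def by (metis scaleR_minus1_left)
  show "T (x - y) = T x - T y" if "x \<in> F" "y \<in> F"
    using add[OF that(1) Fc(4)[OF that(2)]] neg[OF that(2)] by simp
  show "T (modulus x) = modulus (T x)" if "x \<in> F"
    unfolding modulus_def using sup[OF that Fc(4)[OF that]] neg[OF that] by simp
  show "T x \<le> T y" if "x \<in> F" "y \<in> F" "x \<le> y"
    using sup[OF that(1,2)] that(3) by (metis sup.absorb2 sup.cobounded1)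
qed

text \<open>
  A Riesz homomorphism maps approximation regulated by \<open>w\<close> to approximation regulated by the image
  of \<open>w\<close>, so the values of \<open>T\<close> and \<open>S\<close> at \<open>l\<close> differ by at most \<open>(T w + S w) / k\<close> for every \<open>k\<close>.
\<close>

lemma riesz_hom_eq_on_limit:
  fixes T S :: "'v::vector_lattice \<Rightarrow> 'w::vector_lattice"
  assumes F: "vector_sublattice F" and E: "vector_sublattice E" "archimedean E"
    and T: "riesz_hom_on F T" "\<And>x. x \<in> F \<Longrightarrow> T x \<in> E"
    and S: "riesz_hom_on F S" "\<And>x. x \<in> F \<Longrightarrow> S x \<in> E"
    and l: "l \<in> F" and w: "w \<in> F"
    and approx: "\<And>k::nat. k > 0 \<Longrightarrow> \<exists>x\<in>F. T x = S x \<and> modulus (x - l) \<le> (1 / real k) *\<^sub>R w"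
  shows "T l = S l"
proof -
  note Fc = vector_sublattice_closed[OF F] and Ec = vector_sublattice_closed[OF E(1)]
  have image: "modulus (R x - R l) \<le> (1 / real k) *\<^sub>R R w"
    if R: "riesz_hom_on F R" and x: "x \<in> F" "modulus (x - l) \<le> (1 / real k) *\<^sub>R w"
    for R :: "'v \<Rightarrow> 'w" and x and k :: nat
    using riesz_hom_on_simps(7)[OF R F _ _ x(2)] x(1) l w Fc(3,5,8)
    by (simp add: riesz_hom_on_simps(2,5,6)[OF R F])
  have "modulus (T l - S l) \<le> (1 / real k) *\<^sub>R (T w + S w)" if k: "k > 0" for k :: nat
  proof -
    obtain x where x: "x \<in> F" "T x = S x" "modulus (x - l) \<le> (1 / real k) *\<^sub>R w"
      using approx[OF k] by blast
    have "modulus (T l - S l) \<le> modulus (T l - T x) + modulus (S x - S l)"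
      using modulus_triangle_diff[of "T l" "S l" "T x"] x(2) by simp
    also have "\<dots> \<le> (1 / real k) *\<^sub>R T w + (1 / real k) *\<^sub>R S w"
      using image[OF T(1) x(1,3)] image[OF S(1) x(1,3)]
      by (intro add_mono) (simp_all add: modulus_minus_commute[of "T l"])
    finally show ?thesis by (simp add: scaleR_add_right)
  qed
  then have "T l - S l = 0"
    by (intro archimedean_modulus_eq_0[OF E(2,1) _ _, of _ "T w + S w"] Ec(2,3) T(2) S(2) l w)
  then show ?thesis by simp
qed

theorem theorem3:
  fixes F :: "(('a \<Rightarrow> real) \<Rightarrow> real) set"
  assumes "F = \<Inter>{W. vector_sublattice W \<and> W \<subseteq> H \<and> r_closed_in W H \<and> FVL \<subseteq> W}"
  shows "free_UCVL TYPE('e::vector_lattice) F (\<delta> :: 'a \<Rightarrow> ('a \<Rightarrow> real) \<Rightarrow> real)"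
proof -
  have F_least: "F \<subseteq> W"
    if "vector_sublattice W" "W \<subseteq> H" "r_closed_in W H" "range \<delta> \<subseteq> W" for W
    using that FVL_least unfolding assms by blast
  have F: "vector_sublattice F"
    unfolding assms by (rule vector_sublattice_Inter) blast
  have "r_closed_in H (H :: (('a \<Rightarrow> real) \<Rightarrow> real) set)" by (simp add: r_closed_in_def)
  then have F_H: "F \<subseteq> H"
    by (intro F_least[OF vector_sublattice_H order_refl] image_subsetI \<delta>_in_H)
  have FVL_F: "FVL \<subseteq> F" unfolding assms by blast
  have \<delta>_F: "\<delta> a \<in> F" for a by (rule subsetD[OF FVL_F \<delta>_in_FVL])
  have F_closed: "r_closed_in F H" unfolding r_closed_in_def assms by blast
  note Fc = vector_sublattice_closed[OF F]
  have "\<exists>!T. T \<in> F \<rightarrow>\<^sub>E E \<and> riesz_hom_on F T \<and> q = T \<circ> \<delta>"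
    if UE: "UCVL E" and q: "range q \<subseteq> E" for E :: "'e set" and q
  proof -
    have E: "vector_sublattice E" "archimedean E" using UE by (auto simp: UCVL_def)
    obtain G0 where G0: "hom_graph H E G0" "\<And>a. (\<delta> a, q a) \<in> G0"
      using generated_hom_graph[OF E(1) q] by blast
    obtain G where G: "hom_graph H E G" "G0 \<subseteq> G"
      and max: "\<And>G'. hom_graph H E G' \<Longrightarrow> G \<subseteq> G' \<Longrightarrow> G' = G"
      using hom_graph_maximal_extension[OF G0(1)] by blast
    have gen: "(\<delta> a, q a) \<in> G" for a using G0(2) G(2) by blast
    have "G \<subseteq> H \<times> E" using G(1) by (simp add: hom_graph_def)
    then have closed: "r_closure G (H \<times> E) = G"
      by (intro max hom_graph_r_closure[OF G(1) vector_sublattice_H E]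
          subset_r_closure hom_graph_sublattice[OF G(1)])
    have dom_H: "fst ` G \<subseteq> H" using \<open>G \<subseteq> H \<times> E\<close> by auto
    have dom_gen: "range \<delta> \<subseteq> fst ` G" using gen by force
    have FVL_dom: "FVL \<subseteq> fst ` G"
      by (intro FVL_least hom_graph_domain[OF G(1)] dom_H dom_gen)
    have "r_closed_in (fst ` G) H"
    proof (rule hom_graph_r_closed_domain[OF G(1) _ UE])
      show "\<exists>w\<in>fst ` G. modulus u \<le> w" if "u \<in> H" for u
        using FVL_majorizes_H[OF that] FVL_dom by blast
    qed (simp add: closed)
    then have "F \<subseteq> fst ` G" by (intro F_least hom_graph_domain[OF G(1)] dom_H dom_gen)
    then have "\<forall>x\<in>F. \<exists>y. (x, y) \<in> G" by force
    then obtain T0 where T0: "\<And>x. x \<in> F \<Longrightarrow> (x, T0 x) \<in> G" by metis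
    define T where "T = restrict T0 F"
    have T_graph: "(x, T x) \<in> G" if "x \<in> F" for x using T0 that by (simp add: T_def)
    have T_eq: "T x = y" if "x \<in> F" "(x, y) \<in> G" for x y
      using hom_graph_functional[OF G(1) T_graph] that by blast
    have "T \<in> F \<rightarrow>\<^sub>E E" using hom_graph_subset[OF G(1) T0] by (auto simp: T_def)
    moreover have "riesz_hom_on F T"
      unfolding riesz_hom_on_def
      by (intro conjI ballI allI T_eq Fc hom_graph_closed[OF G(1)] hom_graph_scaleR[OF G(1)] T_graph)
    moreover have "q = T \<circ> \<delta>" using T_eq[OF \<delta>_F gen] by auto
    moreover have "S = T'"
      if S: "S \<in> F \<rightarrow>\<^sub>E E" "riesz_hom_on F S" "q = S \<circ> \<delta>"
        and T': "T' \<in> F \<rightarrow>\<^sub>E E" "riesz_hom_on F T'" "q = T' \<circ> \<delta>" for S T'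
    proof -
      define W where "W = {x \<in> F. S x = T' x}"
      note hS = riesz_hom_on_simps[OF S(2) F] and hT = riesz_hom_on_simps[OF T'(2) F]
      have "vector_sublattice W"
      proof (intro vector_sublatticeI subspaceI)
        have "S 0 = 0" "T' 0 = 0" using hS(2)[of 0 0] hT(2)[of 0 0] Fc(1) by simp_all
        then show "0 \<in> W" using Fc(1) by (simp add: W_def)
      qed (simp_all add: W_def Fc hS(1-3) hT(1-3))
      moreover have "W \<subseteq> H" using F_H by (auto simp: W_def)
      moreover have "range \<delta> \<subseteq> W"
        using \<delta>_F S(3) T'(3) unfolding W_def by (auto simp: fun_eq_iff)
      moreover have "r_closed_in W H"
        unfolding r_closed_in_def
      proof (intro allI impI)
        fix x :: "nat \<Rightarrow> _" and l u
        assume x: "\<forall>n. x n \<in> W" and l: "l \<in> H" and u: "u \<in> H"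
          and lim: "r_converges x l u sequentially"
        have "l \<in> F"
          using F_closed x l u lim unfolding r_closed_in_def W_def by blast
        obtain w where w: "w \<in> F" "modulus u \<le> w" using FVL_majorizes_H[OF u] FVL_F by blast
        have "\<exists>x\<in>F. S x = T' x \<and> modulus (x - l) \<le> (1 / real k) *\<^sub>R w" if k: "k > 0" for k :: nat
        proof -
          obtain n where "modulus (x n - l) \<le> (1 / real k) *\<^sub>R modulus u"
            using lim k unfolding r_converges_def eventually_sequentially by blast
          also have "\<dots> \<le> (1 / real k) *\<^sub>R w" using w(2) by (intro scaleR_left_mono) auto
          finally show ?thesis using x by (auto simp: W_def)
        qed
        then have "S l = T' l"
          using S(1) T'(1) by (intro riesz_hom_eq_on_limit[OF F E S(2) _ T'(2) _ \<open>l \<in> F\<close> w(1)]) auto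
        then show "l \<in> W" using \<open>l \<in> F\<close> by (simp add: W_def)
      qed
      ultimately have "F \<subseteq> W" by (intro F_least)
      then show ?thesis by (intro PiE_ext[OF S(1) T'(1)]) (auto simp: W_def)
    qed
    ultimately show ?thesis by blast
  qed
  then show ?thesis
    unfolding free_UCVL_def
    using UCVL_of_r_closed[OF F F_H F_closed] \<delta>_F inj_\<delta> by blast
qed

end
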